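(* Let $d\ge1$ and let $\mathbf n=(n_1,\dots,n_d)$ be a tuple of positive integers. With respect to the graded reverse lexicographic order on $\mathbb R[X]$ described in the context, the following hold. (i) $\mathcal G_0:=\{x_ax_b-x_{a\wedge b}x_{a\vee b}\mid a,b\in[\mathbf n],\ a<b \text{ and } a_i>b_i\text{ for some } i\}$ is the reduced Gröbner basis of $I_0$. (ii) $\mathcal G_1:=\{x_ax_b\mid a,b\in[\mathbf n],\ a<b\}\cup\{\sum_{a\in[\mathbf n]}x_a^2-1\}\cup\{x_a^3-x_a\mid a\in[\mathbf n],\ a>(1,\dots,1)\}$ is the reduced Gröbner basis of $I_1$. (iii) For every even integer $p$ with $2\le p<\infty$, $\mathcal G_p:=\{\sum_{a\in[\mathbf n]}x_a^p-1\}\cup\mathcal G_0$ is the reduced Gröbner basis of $I_p$. (iv) $\mathcal G_\infty:=\{x_a^2-1\mid a\in[\mathbf n]\}\cup\{x_ax_b-x_{a\bar\wedge b}x_{a\bar\vee b}\mid a,b\in[\mathbf n],\ a<b\text{ and, for some } i,\ a_i>b_i\text{ or }a_i=b_i<n_i\}$ is the reduced Gröbner basis of $I_\infty$.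
   Context: $[\mathbf n]=[n_1]\times\cdots\times[n_d]$ with $[m]=\{1,\dots,m\}$; for $a,b\in[\mathbf n]$, $a<b$ means that $a$ is smaller than $b$ in the lexicographic order. $\mathbb R[X]$ is the polynomial ring in the variables $x_a$, $a\in[\mathbf n]$. The monomial order is the graded reverse lexicographic order with variables ordered by $x_a>x_b$ iff $a<b$ (so $x_{1\cdots11}>x_{1\cdots12}>\dots>x_{n_1\cdots n_d}$): monomials are compared first by total degree, and for equal degree $x^\alpha>x^\beta$ iff the last nonzero entry of $\alpha-\beta$ (entries listed from the largest variable to the smallest) is negative. For $a,b\in[\mathbf n]$: $(a\wedge b)_i=\min\{a_i,b_i\}$, $(a\vee b)_i=\max\{a_i,b_i\}$; $(a\bar\wedge b)_i=\min\{a_i,b_i\}$ if $a_i\ne b_i$ and $(a\bar\wedge b)_i=n_i$ if $a_i=b_i$; $(a\bar\vee b)_i=\max\{a_i,b_i\}$ if $a_i\neq b_i$ and $(a\bar\vee b)_i=n_i$ if $a_i=b_i$. Ideals of $\mathbb R[X]$: $I_0=\langle x_ax_b-x_{a\wedge b}x_{a\vee b}\ (a,b\in[\mathbf n])\rangle$; $I_1=\langle x_a^3-x_a\ (a\in[\mathbf n]),\ x_ax_b\ (a\neq b),\ \sum_a x_a^2-1\rangle$; for even $p\ge 2$, $I_p=\langle\sum_a x_a^p-1,\ x_ax_b-x_{a\wedge b}x_{a\vee b}\ (a,b\in[\mathbf n])\rangle$; $I_\infty=\langle x_a^2-1\ (a\in[\mathbf n]),\ x_ax_b-x_{a\wedge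 b}x_{a\vee b}\ (a,b\in[\mathbf n])\rangle$. A Gröbner basis $\mathcal G$ is reduced if every $g\in\mathcal G$ has leading coefficient $1$ and no monomial of $g$ lies in the ideal generated by the leading terms of $\mathcal G\setminus\{g\}$. *)

theory Defs
  imports
    Complex_Main
    "HOL-Algebra.Ideal"
    "HOL-Library.Poly_Mapping"
    "HOL-Library.List_Lexorder"
begin

section \<open>Polynomials over the reals in the variables $x_a$, $a \in V$\<close>

type_synonym 'a mon = "'a \<Rightarrow>\<^sub>0 nat"

type_synonym 'a rpoly = "'a mon \<Rightarrow>\<^sub>0 real"

definition monomial :: "'a mon \<Rightarrow> 'a rpoly" where
  "monomial m = Poly_Mapping.single m 1"

definition var :: "'a \<Rightarrow> 'a rpoly" where
  "var a = monomial (Poly_Mapping.single a 1)"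

text \<open>
  The type \<^typ>\<open>'a rpoly\<close> has a variable for every element of the type
  \<^typ>\<open>'a\<close>; the polynomial ring in the variables indexed by a set \<open>V\<close> is the
  subring of those polynomials in which only these variables occur.
\<close>

definition poly_ring :: "'a set \<Rightarrow> 'a rpoly ring" where
  "poly_ring V =
    \<lparr>carrier = {p. \<forall>m\<in>Poly_Mapping.keys p. Poly_Mapping.keys m \<subseteq> V},
     mult = (*), one = 1, zero = 0, add = (+)\<rparr>"

lemma poly_ring_simps:
  "p \<in> carrier (poly_ring V) \<longleftrightarrow> (\<forall>m\<in>Poly_Mapping.keys p. Poly_Mapping.keys m \<subseteq> V)"
  "p \<otimes>\<^bsub>poly_ring V\<^esub> q = p * q"
  "p \<oplus>\<^bsub>poly_ring V\<^esub> q = p + q"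
  "\<one>\<^bsub>poly_ring V\<^esub> = 1"
  "\<zero>\<^bsub>poly_ring V\<^esub> = 0"
  by (simp_all add: poly_ring_def)

lemma poly_ring_cring: "cring (poly_ring V)"
proof (rule cringI)
  show "abelian_group (poly_ring V)"
  proof (rule abelian_groupI, unfold poly_ring_simps)
    fix p q :: "'a rpoly"
    assume "\<forall>m\<in>Poly_Mapping.keys p. Poly_Mapping.keys m \<subseteq> V"
      and "\<forall>m\<in>Poly_Mapping.keys q. Poly_Mapping.keys m \<subseteq> V"
    then show "\<forall>m\<in>Poly_Mapping.keys (p + q). Poly_Mapping.keys m \<subseteq> V"
      using Poly_Mapping.keys_add[of p q] by blast
  next
    fix p :: "'a rpoly"
    assume "\<forall>m\<in>Poly_Mapping.keys p. Poly_Mapping.keys m \<subseteq> V"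
    then show "\<exists>q\<in>carrier (poly_ring V). q + p = 0"
      by (intro bexI[of _ "- p"]) (simp_all add: poly_ring_simps)
  qed (simp_all add: add.assoc add.commute)
  show "comm_monoid (poly_ring V)"
  proof (rule comm_monoidI, unfold poly_ring_simps)
    fix p q :: "'a rpoly"
    assume p: "\<forall>m\<in>Poly_Mapping.keys p. Poly_Mapping.keys m \<subseteq> V"
      and q: "\<forall>m\<in>Poly_Mapping.keys q. Poly_Mapping.keys m \<subseteq> V"
    show "\<forall>m\<in>Poly_Mapping.keys (p * q). Poly_Mapping.keys m \<subseteq> V"
    proof
      fix m assume "m \<in> Poly_Mapping.keys (p * q)"
      then obtain a b where ab: "a \<in> Poly_Mapping.keys p" "b \<in> Poly_Mapping.keys q" "m = a + b"
        using Poly_Mapping.keys_mult[of p q] by blast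
      then have "Poly_Mapping.keys a \<subseteq> V" "Poly_Mapping.keys b \<subseteq> V"
        using p q by blast+
      then show "Poly_Mapping.keys m \<subseteq> V"
        using Poly_Mapping.keys_add[of a b] ab(3) by blast
    qed
  qed (simp_all add: mult.assoc mult.commute)
qed (simp add: poly_ring_simps distrib_right)


section \<open>Graded reverse lexicographic order and Groebner bases\<close>

definition total_degree :: "'a mon \<Rightarrow> nat" where
  "total_degree m = (\<Sum>a\<in>Poly_Mapping.keys m. Poly_Mapping.lookup m a)"

text \<open>
  The variables are ordered by $x_a > x_b$ iff $a < b$, so listing exponents from the
  largest variable to the smallest means listing them by increasing index.  The index
  \<open>a\<close> below is the last one at which the exponents of \<open>m\<close> and \<open>m'\<close> differ.
\<close>

definition grevlex_less :: "'a::linorder mon \<Rightarrow> 'a mon \<Rightarrow> bool" where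
  "grevlex_less m m' \<longleftrightarrow>
     total_degree m < total_degree m' \<or>
     total_degree m = total_degree m' \<and>
       (\<exists>a. Poly_Mapping.lookup m' a < Poly_Mapping.lookup m a \<and>
            (\<forall>b>a. Poly_Mapping.lookup m' b = Poly_Mapping.lookup m b))"

text \<open>Only meaningful for nonzero polynomials.\<close>

definition leading_monomial :: "'a::linorder rpoly \<Rightarrow> 'a mon" where
  "leading_monomial p =
     (THE m. m \<in> Poly_Mapping.keys p \<and>
        (\<forall>m'\<in>Poly_Mapping.keys p. m' \<noteq> m \<longrightarrow> grevlex_less m' m))"

definition leading_coeff :: "'a::linorder rpoly \<Rightarrow> real" where
  "leading_coeff p = Poly_Mapping.lookup p (leading_monomial p)"

definition leading_term :: "'a::linorder rpoly \<Rightarrow> 'a rpoly" where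
  "leading_term p = Poly_Mapping.single (leading_monomial p) (leading_coeff p)"

definition groebner_basis :: "'a::linorder set \<Rightarrow> 'a rpoly set \<Rightarrow> 'a rpoly set \<Rightarrow> bool" where
  "groebner_basis V I G \<longleftrightarrow>
     finite G \<and> G \<subseteq> I \<and>
     Idl\<^bsub>poly_ring V\<^esub> (leading_term ` G) = Idl\<^bsub>poly_ring V\<^esub> (leading_term ` (I - {0}))"

definition reduced_groebner_basis ::
    "'a::linorder set \<Rightarrow> 'a rpoly set \<Rightarrow> 'a rpoly set \<Rightarrow> bool" where
  "reduced_groebner_basis V I G \<longleftrightarrow>
     groebner_basis V I G \<and>
     (\<forall>g\<in>G. leading_coeff g = 1 \<and>
        (\<forall>m\<in>Poly_Mapping.keys g.
           monomial m \<notin> Idl\<^bsub>poly_ring V\<^esub> (leading_term ` (G - {g}))))"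


section \<open>Index tuples\<close>

text \<open>
  A tuple is a list, so its \<open>i\<close>-th coordinate is at list position \<open>i - 1\<close>.  The relation
  \<open><\<close> on lists is the lexicographic order.
\<close>

definition grid :: "nat list \<Rightarrow> nat list set" where
  "grid n = {a. length a = length n \<and> (\<forall>i<length n. a ! i \<in> {1..n ! i})}"

lemma finite_grid: "finite (grid n)"
proof (rule finite_subset)
  show "grid n \<subseteq> {a. set a \<subseteq> {..Max (set n)} \<and> length a = length n}"
  proof
    fix a assume a: "a \<in> grid n"
    have "a ! i \<le> Max (set n)" if "i < length n" for i
    proof -
      have "a ! i \<le> n ! i"
        using a that by (simp add: grid_def)
      also have "n ! i \<le> Max (set n)"
        using that by (intro Max_ge) simp_all
      finally show ?thesis .
    qed
    with a show "a \<in> {a. set a \<subseteq> {..Max (set n)} \<and> length a = length n}"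
      by (auto simp: grid_def set_conv_nth)
  qed
qed (rule finite_lists_length_eq, simp)

definition meet :: "nat list \<Rightarrow> nat list \<Rightarrow> nat list" where
  "meet a b = map2 min a b"

definition join :: "nat list \<Rightarrow> nat list \<Rightarrow> nat list" where
  "join a b = map2 max a b"

definition meet_bar :: "nat list \<Rightarrow> nat list \<Rightarrow> nat list \<Rightarrow> nat list" where
  "meet_bar n a b =
     map (\<lambda>i. if a ! i \<noteq> b ! i then min (a ! i) (b ! i) else n ! i) [0..<length n]"

definition join_bar :: "nat list \<Rightarrow> nat list \<Rightarrow> nat list \<Rightarrow> nat list" where
  "join_bar n a b =
     map (\<lambda>i. if a ! i \<noteq> b ! i then max (a ! i) (b ! i) else n ! i) [0..<length n]"


section \<open>The ideals\<close>

definition binomials :: "nat list \<Rightarrow> nat list rpoly set" where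
  "binomials n =
     {var a * var b - var (meet a b) * var (join a b) | a b. a \<in> grid n \<and> b \<in> grid n}"

definition ideal_0 :: "nat list \<Rightarrow> nat list rpoly set" where
  "ideal_0 n = Idl\<^bsub>poly_ring (grid n)\<^esub> (binomials n)"

definition ideal_1 :: "nat list \<Rightarrow> nat list rpoly set" where
  "ideal_1 n = Idl\<^bsub>poly_ring (grid n)\<^esub>
     ({var a ^ 3 - var a | a. a \<in> grid n}
      \<union> {var a * var b | a b. a \<in> grid n \<and> b \<in> grid n \<and> a \<noteq> b}
      \<union> {(\<Sum>a\<in>grid n. var a ^ 2) - 1})"

definition ideal_p :: "nat \<Rightarrow> nat list \<Rightarrow> nat list rpoly set" where
  "ideal_p p n = Idl\<^bsub>poly_ring (grid n)\<^esub>
     ({(\<Sum>a\<in>grid n. var a ^ p) - 1} \<union> binomials n)"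

definition ideal_inf :: "nat list \<Rightarrow> nat list rpoly set" where
  "ideal_inf n = Idl\<^bsub>poly_ring (grid n)\<^esub>
     ({var a ^ 2 - 1 | a. a \<in> grid n} \<union> binomials n)"


section \<open>The bases\<close>

definition gb_0 :: "nat list \<Rightarrow> nat list rpoly set" where
  "gb_0 n =
     {var a * var b - var (meet a b) * var (join a b) | a b.
        a \<in> grid n \<and> b \<in> grid n \<and> a < b \<and> (\<exists>i<length n. a ! i > b ! i)}"

definition gb_1 :: "nat list \<Rightarrow> nat list rpoly set" where
  "gb_1 n =
     {var a * var b | a b. a \<in> grid n \<and> b \<in> grid n \<and> a < b}
     \<union> {(\<Sum>a\<in>grid n. var a ^ 2) - 1}
     \<union> {var a ^ 3 - var a | a. a \<in> grid n \<and> a > replicate (length n) 1}"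

definition gb_p :: "nat \<Rightarrow> nat list \<Rightarrow> nat list rpoly set" where
  "gb_p p n = {(\<Sum>a\<in>grid n. var a ^ p) - 1} \<union> gb_0 n"

definition gb_inf :: "nat list \<Rightarrow> nat list rpoly set" where
  "gb_inf n =
     {var a ^ 2 - 1 | a. a \<in> grid n}
     \<union> {var a * var b - var (meet_bar n a b) * var (join_bar n a b) | a b.
          a \<in> grid n \<and> b \<in> grid n \<and> a < b \<and>
          (\<exists>i<length n. a ! i > b ! i \<or> (a ! i = b ! i \<and> b ! i < n ! i))}"

end

theory Submission
  imports Defs
begin

text \<open>
  The set \<open>G\<close> is a Groebner basis of the ideal \<open>I\<close> as soon as the leading monomial of every
  nonzero \<open>f \<in> I\<close> is divisible by the leading monomial of an element of \<open>G\<close>.  The proof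
  establishes this directly, without S-polynomials: for \<open>I\<^sub>0\<close>, \<open>I\<^sub>1\<close> and \<open>I\<^sub>\<infinity>\<close> it exhibits
  linear functionals that vanish on \<open>I\<close>, and evaluates them at an \<open>f\<close> whose leading monomial
  would be standard, i.e. divisible by no leading monomial of \<open>G\<close>; the remaining ideals are
  reduced to \<open>I\<^sub>0\<close>.

  For a binomial ideal the functionals are sums of coefficients over the classes of an
  equivalence relation on monomials that is compatible with multiplication and identifies the
  two monomials of every generator.  Such a sum can vanish only if the leading monomial of \<open>f\<close> shares
  its class with a smaller monomial of \<open>f\<close> (\<open>leading_monomial_not_fibre_minimum\<close>).  So it
  suffices that a standard monomial is the smallest monomial of its class.

  \<^item> For \<open>I\<^sub>0\<close> the relation compares, for each coordinate \<open>i\<close> and each value \<open>k\<close>, the number of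
    variables \<open>x\<^sub>a\<close> with \<open>a\<^sub>i = k\<close>; this is the toric parametrization \<open>x\<^sub>a \<mapsto> \<Prod>\<^sub>i t\<^sub>i\<^sub>,\<^sub>a\<^sub>i\<close>.
    Standard monomials are those supported on a chain of the product order.  If a monomial of
    the same class were smaller, then after cancelling common variables it would contain a
    variable \<open>x\<^sub>a\<close> with \<open>a\<close> lexicographically above the whole chain.  But every coordinate of
    \<open>a\<close> occurs in the chain, so \<open>a\<close> is componentwise below the top of the chain: a
    contradiction (\<open>chain_grevlex_minimal\<close>).
  \<^item> For \<open>I\<^sub>\<infinity>\<close> the same numbers are compared modulo 2, together with the parity of the degree.
    Standard monomials are squarefree products over strict chains, and these carry so many
    distinct coordinates that no monomial of the class has smaller degree; the argument for
    \<open>I\<^sub>0\<close> then applies again (\<open>strict_chain_grevlex_minimal\<close>).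
  \<^item> For \<open>I\<^sub>1\<close> the functionals are the even and the odd part of the evaluation at the unit vectors.
  \<^item> For \<open>I\<^sub>p\<close> with finite \<open>p\<close>, every \<open>f \<in> I\<^sub>p\<close> is \<open>h (\<Sum> x\<^sub>a\<^sup>p - 1) + g\<close> with \<open>g \<in> I\<^sub>0\<close> and \<open>h\<close>
    supported on chains.  The smallest tuple is comparable to all others, so the leading monomial of
    the first summand is supported on a chain, whereas that of \<open>g\<close> is not.  Hence the two
    cannot cancel, and the larger of them is the leading monomial of \<open>f\<close>.
\<close>

abbreviation (input) "lookup \<equiv> Poly_Mapping.lookup"
abbreviation (input) "keys \<equiv> Poly_Mapping.keys"
abbreviation (input) "single \<equiv> Poly_Mapping.single"

section \<open>Weights and the order on monomials\<close>

text \<open>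
  Total degrees and the numbers of variables with a prescribed coordinate are both additive weights.
\<close>
definition weight :: "('a \<Rightarrow> nat) \<Rightarrow> 'a mon \<Rightarrow> nat" where
  "weight \<omega> m = (\<Sum>a\<in>keys m. lookup m a * \<omega> a)"

lemma weight_superset:
  assumes "finite A" "keys m \<subseteq> A"
  shows "weight \<omega> m = (\<Sum>a\<in>A. lookup m a * \<omega> a)"
  unfolding weight_def using assms by (intro sum.mono_neutral_left) (auto simp: in_keys_iff)

lemma weight_add: "weight \<omega> (m + m') = weight \<omega> m + weight \<omega> m'"
proof -
  let ?A = "keys m \<union> keys m'"
  have "keys (m + m') \<subseteq> ?A" by (rule Poly_Mapping.keys_add)
  then show ?thesis
    by (simp add: weight_superset[where A = ?A] lookup_add sum.distrib distrib_right)
qed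

lemma weight_single [simp]: "weight \<omega> (single a k) = k * \<omega> a"
  by (subst weight_superset[where A = "{a}"]) auto

lemma total_degree_eq_weight: "total_degree m = weight (\<lambda>_. 1) m"
  by (simp add: total_degree_def weight_def)

lemma total_degree_add: "total_degree (m + m') = total_degree m + total_degree m'"
  by (simp add: total_degree_eq_weight weight_add)

lemma total_degree_zero [simp]: "total_degree 0 = 0"
  by (simp add: total_degree_def)

lemma total_degree_single [simp]: "total_degree (single a k) = k"
  by (simp add: total_degree_eq_weight)

lemma total_degree_eq_0_iff: "total_degree m = 0 \<longleftrightarrow> m = 0"
proof
  assume "total_degree m = 0"
  then have "lookup m a = 0" for a
    by (cases "a \<in> keys m") (auto simp: total_degree_def in_keys_iff)
  then show "m = 0" by (simp add: poly_mapping_eqI)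
qed simp

lemma max_of_monomials: "m + (m' - m) = m' + (m - m')" for m m' :: "'a mon"
  by (rule poly_mapping_eqI) (simp add: lookup_add lookup_minus)

lemma exists_last_difference:
  fixes m m' :: "'a::linorder mon"
  assumes "m \<noteq> m'"
  obtains a where "lookup m a \<noteq> lookup m' a" "\<And>b. b > a \<Longrightarrow> lookup m b = lookup m' b"
proof -
  let ?D = "{a. lookup m a \<noteq> lookup m' a}"
  have "?D \<subseteq> keys m \<union> keys m'" by (auto simp: in_keys_iff)
  then have fin: "finite ?D" by (rule finite_subset) simp
  have ne: "?D \<noteq> {}" using assms poly_mapping_eqI[of m m'] by auto
  from Max_in[OF fin ne] Max_ge[OF fin] that[of "Max ?D"] show ?thesis
    by (metis (mono_tags, lifting) linorder_not_le mem_Collect_eq)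
qed

lemma grevlex_irrefl [simp]: "\<not> grevlex_less m m"
  by (auto simp: grevlex_less_def)

lemma grevlex_trans:
  assumes "grevlex_less k l" "grevlex_less l m"
  shows "grevlex_less k m"
proof (cases "total_degree k = total_degree l \<and> total_degree l = total_degree m")
  case True
  then obtain a b where a: "lookup l a < lookup k a" "\<forall>c>a. lookup l c = lookup k c"
    and b: "lookup m b < lookup l b" "\<forall>c>b. lookup m c = lookup l c"
    using assms by (auto simp: grevlex_less_def)
  have "lookup m (max a b) < lookup k (max a b)"
    using a b by (cases a b rule: linorder_cases) (auto simp: max_def)
  moreover have "\<forall>c>max a b. lookup m c = lookup k c" using a b by auto
  ultimately show ?thesis using True by (auto simp: grevlex_less_def)
qed (use assms in \<open>auto simp: grevlex_less_def\<close>)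

lemma grevlex_asym: "grevlex_less k l \<Longrightarrow> \<not> grevlex_less l k"
  using grevlex_trans grevlex_irrefl by blast

lemma grevlex_total: "m \<noteq> m' \<Longrightarrow> grevlex_less m m' \<or> grevlex_less m' m"
proof (cases "total_degree m = total_degree m'")
  case True
  assume "m \<noteq> m'"
  then obtain a where "lookup m a \<noteq> lookup m' a" "\<And>b. b > a \<Longrightarrow> lookup m b = lookup m' b"
    using exists_last_difference by blast
  then show ?thesis
    using True by (cases "lookup m a" "lookup m' a" rule: linorder_cases)
      (auto simp: grevlex_less_def)
qed (auto simp: grevlex_less_def)

lemma grevlex_add_iff [simp]: "grevlex_less (u + m) (u + m') \<longleftrightarrow> grevlex_less m m'"
  by (simp add: grevlex_less_def total_degree_add lookup_add)

lemma grevlex_add_iff' [simp]: "grevlex_less (m + u) (m' + u) \<longleftrightarrow> grevlex_less m m'"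
  using grevlex_add_iff[of u m m'] by (simp add: add.commute)

lemma asymp_grevlex: "asymp_on A grevlex_less" and transp_grevlex: "transp_on A grevlex_less"
  by (auto intro: asymp_onI transp_onI dest: grevlex_asym grevlex_trans)

text \<open>
  Cancelling the common part of two monomials of equal degree leaves \<open>m' - m\<close> and \<open>m - m'\<close>
  (with truncated subtraction), and the last variable that remains belongs to the smaller one.
\<close>
lemma grevlex_differenceE:
  assumes "grevlex_less m' m" "total_degree m' = total_degree m"
  obtains a where "a \<in> keys (m' - m)" "\<And>b. b \<in> keys (m - m') \<Longrightarrow> b < a"
proof -
  obtain a where a: "lookup m a < lookup m' a" "\<forall>b>a. lookup m b = lookup m' b"
    using assms by (auto simp: grevlex_less_def)
  show thesis
  proof (rule that)
    show "a \<in> keys (m' - m)" using a by (simp add: in_keys_iff lookup_minus)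
    fix b assume "b \<in> keys (m - m')"
    then have "lookup m b > lookup m' b" by (simp add: in_keys_iff lookup_minus)
    then show "b < a" using a by (metis linorder_cases order.asym order.irrefl)
  qed
qed

section \<open>Divisibility of monomials\<close>

definition mon_dvd :: "'a mon \<Rightarrow> 'a mon \<Rightarrow> bool" where
  "mon_dvd l m \<longleftrightarrow> (\<forall>a. lookup l a \<le> lookup m a)"

lemma mon_dvd_imp_diff_add: "mon_dvd l m \<Longrightarrow> (m - l) + l = m"
  by (rule poly_mapping_eqI) (simp add: mon_dvd_def lookup_add lookup_minus)

lemma mon_dvd_add: "mon_dvd l m \<Longrightarrow> mon_dvd l (u + m)"
  by (simp add: mon_dvd_def lookup_add trans_le_add2)

lemma mon_dvd_refl [simp]: "mon_dvd m m"
  by (simp add: mon_dvd_def)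

lemma keys_diff_subset: "keys (m - l) \<subseteq> keys m" for m l :: "'a mon"
  by (auto simp: in_keys_iff lookup_minus)

lemma mon_dvd_single_iff: "mon_dvd (single a k) m \<longleftrightarrow> k \<le> lookup m a"
  by (auto simp: mon_dvd_def lookup_single when_def)

definition pair :: "'a \<Rightarrow> 'a \<Rightarrow> 'a mon" where
  "pair a b = single a 1 + single b 1"

lemma lookup_pair: "lookup (pair a b) c = (if c = a then 1 else 0) + (if c = b then 1 else 0)"
  by (auto simp: pair_def lookup_add lookup_single)

lemma keys_pair [simp]: "keys (pair a b) = {a, b}"
  by (auto simp: in_keys_iff lookup_pair split: if_splits)

lemma total_degree_pair [simp]: "total_degree (pair a b) = 2"
  by (simp add: pair_def total_degree_add)

lemma mon_dvd_pair_iff: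
  assumes "a \<noteq> b"
  shows "mon_dvd (pair a b) m \<longleftrightarrow> a \<in> keys m \<and> b \<in> keys m"
proof
  assume dvd: "mon_dvd (pair a b) m"
  have "lookup (pair a b) c \<le> lookup m c" for c using dvd by (simp add: mon_dvd_def)
  from this[of a] this[of b] show "a \<in> keys m \<and> b \<in> keys m"
    using assms by (simp add: lookup_pair in_keys_iff)
qed (use assms in \<open>auto simp: mon_dvd_def lookup_pair in_keys_iff\<close>)

section \<open>Polynomials\<close>

lemma keys_single_subset: "keys (single m c) \<subseteq> {m}"
  by simp

lemma poly_eq_sum_singles: "p = (\<Sum>m\<in>keys p. single m (lookup p m))"
  by (rule poly_mapping_eqI) (auto simp: lookup_sum lookup_single when_def in_keys_iff)

lemma keys_empty_iff: "keys p = {} \<longleftrightarrow> p = 0"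
proof
  assume "keys p = {}"
  then have "lookup p k = 0" for k by (metis empty_iff in_keys_iff)
  then show "p = 0" by (intro poly_mapping_eqI) simp
qed simp

lemma leading_monomial_eqI:
  assumes "m \<in> keys p" "\<And>m'. m' \<in> keys p \<Longrightarrow> m' \<noteq> m \<Longrightarrow> grevlex_less m' m"
  shows "leading_monomial p = m"
  unfolding leading_monomial_def
proof (rule the_equality)
  fix l assume l: "l \<in> keys p \<and> (\<forall>m'\<in>keys p. m' \<noteq> l \<longrightarrow> grevlex_less m' l)"
  show "l = m"
  proof (rule ccontr)
    assume "l \<noteq> m"
    with l assms have less: "grevlex_less m l" "grevlex_less l m" by simp_all
    show False using grevlex_asym[OF less(1)] less(2) by simp
  qed
qed (use assms in simp)

lemma leading_monomial:
  assumes "p \<noteq> 0"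
  shows leading_monomial_in_keys: "leading_monomial p \<in> keys p"
    and grevlex_less_leading_monomial:
      "\<And>m. m \<in> keys p \<Longrightarrow> m \<noteq> leading_monomial p \<Longrightarrow> grevlex_less m (leading_monomial p)"
proof -
  obtain l where l: "l \<in> keys p" "\<forall>m\<in>keys p. m \<noteq> l \<longrightarrow> \<not> grevlex_less l m"
    using Finite_Set.bex_max_element[OF finite_keys[of p] asymp_grevlex transp_grevlex] assms
    by (auto simp: keys_empty_iff)
  then have *: "\<And>m. m \<in> keys p \<Longrightarrow> m \<noteq> l \<Longrightarrow> grevlex_less m l"
    using grevlex_total by blast
  have lm: "leading_monomial p = l" by (rule leading_monomial_eqI[OF l(1) *])
  show "leading_monomial p \<in> keys p" unfolding lm by (rule l(1))
  show "grevlex_less m (leading_monomial p)" if "m \<in> keys p" "m \<noteq> leading_monomial p" for m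
    using * that unfolding lm by blast
qed

lemma leading_monomial_add:
  assumes "p \<noteq> 0" "q \<noteq> 0" "grevlex_less (leading_monomial q) (leading_monomial p)"
  shows "leading_monomial (p + q) = leading_monomial p"
proof (rule leading_monomial_eqI)
  have less: "grevlex_less m (leading_monomial p)" if "m \<in> keys q" for m
    using grevlex_less_leading_monomial[OF assms(2) that] assms(3)
      grevlex_trans[OF _ assms(3), of m] by auto
  then have "leading_monomial p \<notin> keys q" using grevlex_irrefl by blast
  then show "leading_monomial p \<in> keys (p + q)"
    using leading_monomial_in_keys[OF assms(1)] by (simp add: in_keys_iff lookup_add)
  show "grevlex_less m (leading_monomial p)"
    if "m \<in> keys (p + q)" "m \<noteq> leading_monomial p" for m
    using that less grevlex_less_leading_monomial[OF assms(1)] Poly_Mapping.keys_add[of p q]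
    by blast
qed

text \<open>
  Splitting off the leading terms of both factors, all remaining products are smaller because
  the order is compatible with multiplication, so nothing cancels the product of the leading terms.
\<close>
lemma leading_monomial_mult:
  assumes "p \<noteq> 0" "q \<noteq> 0"
  shows "p * q \<noteq> 0" "leading_monomial (p * q) = leading_monomial p + leading_monomial q"
proof -
  let ?k = "leading_monomial p" and ?l = "leading_monomial q"
  define c where "c = lookup p ?k"
  define e where "e = lookup q ?l"
  define p' where "p' = p - single ?k c"
  define q' where "q' = q - single ?l e"
  have c: "c \<noteq> 0" and e: "e \<noteq> 0"
    using assms leading_monomial_in_keys by (auto simp: c_def e_def in_keys_iff)
  have p': "grevlex_less m ?k" if "m \<in> keys p'" for m
  proof -
    have "m \<in> keys p" "m \<noteq> ?k"
      using that by (auto simp: p'_def c_def in_keys_iff lookup_minus lookup_single when_def split: if_splits)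
    then show ?thesis using grevlex_less_leading_monomial[OF assms(1)] by blast
  qed
  have q': "grevlex_less m ?l" if "m \<in> keys q'" for m
  proof -
    have "m \<in> keys q" "m \<noteq> ?l"
      using that by (auto simp: q'_def e_def in_keys_iff lookup_minus lookup_single when_def split: if_splits)
    then show ?thesis using grevlex_less_leading_monomial[OF assms(2)] by blast
  qed
  let ?r = "single ?k c * q' + p' * q"
  have "p * q = single ?k c * single ?l e + ?r"
    by (simp add: p'_def q'_def algebra_simps)
  then have pq: "p * q = single (?k + ?l) (c * e) + ?r"
    by (simp add: mult_single)
  have r: "grevlex_less m (?k + ?l)" if "m \<in> keys ?r" for m
  proof -
    have "m \<in> keys (single ?k c * q') \<or> m \<in> keys (p' * q)"
      using subsetD[OF Poly_Mapping.keys_add that] by simp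
    then show ?thesis
    proof
      assume "m \<in> keys (single ?k c * q')"
      then obtain a b where "m = a + b" "a \<in> keys (single ?k c)" "b \<in> keys q'"
        using keys_mult[of "single ?k c" q'] by blast
      moreover from this(2) have "a = ?k" using keys_single_subset[of ?k c] by blast
      ultimately have "m = ?k + b" "b \<in> keys q'" by simp_all
      then show ?thesis using q' by simp
    next
      assume "m \<in> keys (p' * q)"
      then obtain a b where m: "m = a + b" "a \<in> keys p'" "b \<in> keys q"
        using keys_mult[of p' q] by blast
      have "grevlex_less (a + b) (?k + b)" using p'[OF m(2)] by simp
      moreover have "b = ?l \<or> grevlex_less (?k + b) (?k + ?l)"
        using grevlex_less_leading_monomial[OF assms(2) m(3)] by auto
      ultimately show ?thesis
        using m(1) grevlex_trans[of "a + b" "?k + b" "?k + ?l"] by auto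
    qed
  qed
  then have notin: "?k + ?l \<notin> keys ?r" using grevlex_irrefl by blast
  have mem: "?k + ?l \<in> keys (p * q)"
  proof -
    have "lookup (p * q) (?k + ?l) = c * e"
      using notin unfolding pq by (simp add: lookup_add in_keys_iff)
    then show ?thesis using c e by (simp add: in_keys_iff)
  qed
  then show "p * q \<noteq> 0" by auto
  show "leading_monomial (p * q) = ?k + ?l"
  proof (rule leading_monomial_eqI[OF mem])
    fix m assume "m \<in> keys (p * q)" "m \<noteq> ?k + ?l"
    then have "m \<in> keys ?r"
      unfolding pq by (auto simp: in_keys_iff lookup_add lookup_single when_def)
    then show "grevlex_less m (?k + ?l)" by (rule r)
  qed
qed

lemma var_power: "var a ^ k = monomial (single a k)"
proof (induction k)
  case (Suc k)
  have "single a (Suc k) = single a 1 + single a k" by (simp flip: single_add)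
  with Suc show ?case by (simp add: var_def monomial_def mult_single)
qed (simp add: monomial_def)

lemma var_times_var: "var a * var b = monomial (pair a b)"
  by (simp add: var_def monomial_def pair_def mult_single)

lemma one_eq_monomial: "1 = monomial 0"
  by (simp add: monomial_def)

lemma keys_monomial_diff:
  assumes "m \<noteq> m'"
  shows "keys (monomial m - monomial m') = {m, m'}"
  using assms by (auto simp: monomial_def in_keys_iff lookup_minus lookup_single when_def split: if_splits)

lemma leading_binomial:
  assumes "grevlex_less m' m"
  shows "leading_monomial (monomial m - monomial m') = m"
    "leading_coeff (monomial m - monomial m') = 1"
    "keys (monomial m - monomial m') = {m, m'}"
proof -
  have ne: "m \<noteq> m'" using assms by auto
  show k: "keys (monomial m - monomial m') = {m, m'}" by (rule keys_monomial_diff[OF ne])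
  show l: "leading_monomial (monomial m - monomial m') = m"
    by (rule leading_monomial_eqI) (use k assms in auto)
  show "leading_coeff (monomial m - monomial m') = 1"
    using ne unfolding leading_coeff_def l by (simp add: monomial_def lookup_minus lookup_single)
qed

lemma leading_monomial_monomial:
  "leading_monomial (monomial m) = m" "leading_coeff (monomial m) = 1" "keys (monomial m) = {m}"
proof -
  show "keys (monomial m) = {m}" by (simp add: monomial_def)
  show "leading_monomial (monomial m) = m"
    by (rule leading_monomial_eqI) (auto simp: monomial_def)
  then show "leading_coeff (monomial m) = 1" by (simp add: leading_coeff_def monomial_def)
qed

lemma grevlex_single: "0 < k \<Longrightarrow> a < b \<Longrightarrow> grevlex_less (single b k) (single a k)"
  unfolding grevlex_less_def by (intro disjI2 conjI exI[of _ b]) (auto simp: lookup_single when_def)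

text \<open>
  The smallest variable decides the comparison of quadratic monomials, and here it occurs
  only in the product of \<open>x\<^sub>c\<close> and \<open>x\<^sub>d\<close>.
\<close>
lemma grevlex_pair:
  assumes "a < d" "b < d" "c \<le> (d::'a::linorder)"
  shows "grevlex_less (pair c d) (pair a b)"
  unfolding grevlex_less_def using assms
  by (intro disjI2 conjI exI[of _ d]) (auto simp: lookup_pair)

lemma leading_power_sum:
  fixes V :: "'a::linorder set"
  assumes V: "finite V" "e \<in> V" "\<And>a. a \<in> V \<Longrightarrow> e \<le> a" and k: "k > 0"
  defines "s \<equiv> (\<Sum>a\<in>V. var a ^ k) - 1"
  shows "leading_monomial s = single e k" "leading_coeff s = 1"
    "keys s = insert 0 ((\<lambda>a. single a k) ` V)"
proof -
  have inj: "single a k = single b k \<longleftrightarrow> a = b" for a b :: 'a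
    using k by (metis keys_single less_not_refl singleton_inject)
  have nz: "single a k \<noteq> 0" for a :: 'a
    using k by (metis keys_single keys_zero insert_not_empty less_not_refl)
  have lk: "lookup s m = (\<Sum>a\<in>V. if single a k = m then 1 else 0) - (if m = 0 then 1 else 0)" for m
    by (simp add: s_def var_power monomial_def lookup_minus lookup_sum lookup_single lookup_one when_def)
  have l0: "lookup s 0 = -1" unfolding lk by (simp add: nz)
  have l1: "lookup s (single b k) = 1" if "b \<in> V" for b
    unfolding lk using that V(1) by (simp add: nz inj)
  have l2: "lookup s m = 0" if "m \<noteq> 0" "m \<notin> (\<lambda>a. single a k) ` V" for m
  proof -
    have "\<forall>a\<in>V. single a k \<noteq> m" using that by blast
    then show ?thesis unfolding lk using that by simp
  qed
  show ks: "keys s = insert 0 ((\<lambda>a. single a k) ` V)"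
  proof (rule Set.set_eqI)
    fix m
    show "m \<in> keys s \<longleftrightarrow> m \<in> insert 0 ((\<lambda>a. single a k) ` V)"
    proof (cases "m = 0 \<or> m \<in> (\<lambda>a. single a k) ` V")
      case True
      then have "lookup s m \<noteq> 0" by (elim disjE imageE) (simp_all add: l0 l1)
      with True show ?thesis unfolding in_keys_iff by blast
    next
      case False
      then show ?thesis using l2[of m] by (simp add: in_keys_iff)
    qed
  qed
  show lm: "leading_monomial s = single e k"
  proof (rule leading_monomial_eqI)
    show "single e k \<in> keys s" using V ks by auto
    fix m assume "m \<in> keys s" "m \<noteq> single e k"
    then consider "m = 0" | b where "b \<in> V" "m = single b k" "b \<noteq> e" using ks by auto
    then show "grevlex_less m (single e k)"
    proof cases
      case 1
      then show ?thesis using k by (simp add: grevlex_less_def)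
    next
      case 2
      then show ?thesis using V(3)[of b] k by (simp add: grevlex_single)
    qed
  qed
  show "leading_coeff s = 1" using l1[OF V(2)] by (simp add: leading_coeff_def lm)
qed

section \<open>Ideals\<close>

lemma ideal_poly_ringI:
  assumes "J \<subseteq> carrier (poly_ring V)" "0 \<in> J" "\<And>p q. p \<in> J \<Longrightarrow> q \<in> J \<Longrightarrow> p + q \<in> J"
    and mult: "\<And>p q. p \<in> carrier (poly_ring V) \<Longrightarrow> q \<in> J \<Longrightarrow> p * q \<in> J"
  shows "ideal J (poly_ring V)"
proof -
  interpret cring "poly_ring V" by (rule poly_ring_cring)
  have neg: "\<ominus>\<^bsub>poly_ring V\<^esub> p = - 1 * p" if "p \<in> carrier (poly_ring V)" for p
    using that by (intro minus_equality) (auto simp: poly_ring_simps)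
  have m1: "- 1 \<in> carrier (poly_ring V)" by (simp add: poly_ring_simps)
  show ?thesis
  proof (rule idealI)
    show "subgroup J (add_monoid (poly_ring V))"
    proof
      show "inv\<^bsub>add_monoid (poly_ring V)\<^esub> p \<in> J" if "p \<in> J" for p
        using neg[of p] mult[OF m1 that] that assms(1) unfolding a_inv_def by auto
    qed (use assms in \<open>auto simp: poly_ring_simps\<close>)
  next
    show "q \<otimes>\<^bsub>poly_ring V\<^esub> p \<in> J" "p \<otimes>\<^bsub>poly_ring V\<^esub> q \<in> J"
      if "p \<in> J" "q \<in> carrier (poly_ring V)" for p q
      using mult[OF that(2,1)] by (simp_all add: poly_ring_simps mult.commute)
  qed (rule ring_axioms)
qed

lemma single_in_carrier: "keys m \<subseteq> V \<Longrightarrow> single m c \<in> carrier (poly_ring V)"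
  by (simp add: poly_ring_simps)

text \<open>
  Elements of an ideal are sums of monomial multiples of generators.  Reducing the cofactors to
  single terms leaves a property to be checked only on explicit, sparse polynomials.
\<close>
lemma ideal_induct [consumes 2, case_names zero add monomial]:
  assumes f: "f \<in> Idl\<^bsub>poly_ring V\<^esub> B" and B: "B \<subseteq> carrier (poly_ring V)"
    and "P 0" "\<And>p q. P p \<Longrightarrow> P q \<Longrightarrow> P (p + q)"
    and mon: "\<And>m c b. keys m \<subseteq> V \<Longrightarrow> b \<in> B \<Longrightarrow> P (single m c * b)"
  shows "P f"
proof -
  interpret cring "poly_ring V" by (rule poly_ring_cring)
  define J where "J = {p \<in> carrier (poly_ring V). \<forall>q\<in>carrier (poly_ring V). P (q * p)}"
  have "ideal J (poly_ring V)"
  proof (rule ideal_poly_ringI)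
    show "p + q \<in> J" if "p \<in> J" "q \<in> J" for p q
      using that assms(4) add.m_closed[of p q] by (auto simp: J_def distrib_left poly_ring_simps(3))
    show "p * q \<in> J" if "p \<in> carrier (poly_ring V)" "q \<in> J" for p q
      using that m_closed by (auto simp: J_def poly_ring_simps(2) simp flip: mult.assoc)
  qed (use \<open>P 0\<close> in \<open>auto simp: J_def poly_ring_simps\<close>)
  moreover have "B \<subseteq> J"
  proof
    fix b assume b: "b \<in> B"
    have "P (q * b)" if q: "q \<in> carrier (poly_ring V)" for q
    proof -
      have "P (\<Sum>m\<in>A. single m (lookup q m) * b)" if "A \<subseteq> keys q" for A
        using finite_subset[OF that finite_keys] that
      proof (induction A rule: finite_induct)
        case (insert m A)
        then show ?case using q b mon assms(4) by (simp add: poly_ring_simps)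
      qed (simp add: \<open>P 0\<close>)
      from this[of "keys q"] show ?thesis
        by (simp flip: sum_distrib_right poly_eq_sum_singles)
    qed
    then show "b \<in> J" using b B by (auto simp: J_def)
  qed
  ultimately have "Idl\<^bsub>poly_ring V\<^esub> B \<subseteq> J" by (rule genideal_minimal)
  with f have "f \<in> J" by blast
  then have "P (1 * f)" unfolding J_def using one_closed by (auto simp: poly_ring_simps(4))
  then show ?thesis by simp
qed

lemma
  assumes "B \<subseteq> carrier (poly_ring V)"
  shows gen_in_ideal: "p \<in> B \<Longrightarrow> p \<in> Idl\<^bsub>poly_ring V\<^esub> B"
    and ideal_subset_carrier: "Idl\<^bsub>poly_ring V\<^esub> B \<subseteq> carrier (poly_ring V)"
    and zero_in_ideal: "0 \<in> Idl\<^bsub>poly_ring V\<^esub> B"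
    and add_in_ideal: "p \<in> Idl\<^bsub>poly_ring V\<^esub> B \<Longrightarrow> q \<in> Idl\<^bsub>poly_ring V\<^esub> B \<Longrightarrow> p + q \<in> Idl\<^bsub>poly_ring V\<^esub> B"
    and mult_in_ideal: "r \<in> carrier (poly_ring V) \<Longrightarrow> q \<in> Idl\<^bsub>poly_ring V\<^esub> B \<Longrightarrow> r * q \<in> Idl\<^bsub>poly_ring V\<^esub> B"
    and diff_in_ideal: "p \<in> Idl\<^bsub>poly_ring V\<^esub> B \<Longrightarrow> q \<in> Idl\<^bsub>poly_ring V\<^esub> B \<Longrightarrow> p - q \<in> Idl\<^bsub>poly_ring V\<^esub> B"
proof -
  interpret cring "poly_ring V" by (rule poly_ring_cring)
  interpret I: ideal "Idl\<^bsub>poly_ring V\<^esub> B" "poly_ring V" by (rule genideal_ideal[OF assms])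
  show "p \<in> B \<Longrightarrow> p \<in> Idl\<^bsub>poly_ring V\<^esub> B" using genideal_self[OF assms] by blast
  show "Idl\<^bsub>poly_ring V\<^esub> B \<subseteq> carrier (poly_ring V)" by (rule I.a_subset)
  show "0 \<in> Idl\<^bsub>poly_ring V\<^esub> B" using I.zero_closed by (simp add: poly_ring_simps)
  show add: "p + q \<in> Idl\<^bsub>poly_ring V\<^esub> B" if "p \<in> Idl\<^bsub>poly_ring V\<^esub> B" "q \<in> Idl\<^bsub>poly_ring V\<^esub> B" for p q
    using I.a_closed[OF that] by (simp add: poly_ring_simps)
  show mult: "r * q \<in> Idl\<^bsub>poly_ring V\<^esub> B" if "r \<in> carrier (poly_ring V)" "q \<in> Idl\<^bsub>poly_ring V\<^esub> B" for r q
    using I.I_l_closed[OF that(2,1)] by (simp add: poly_ring_simps)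
  show "p - q \<in> Idl\<^bsub>poly_ring V\<^esub> B" if "p \<in> Idl\<^bsub>poly_ring V\<^esub> B" "q \<in> Idl\<^bsub>poly_ring V\<^esub> B"
    using add[OF that(1) mult[OF _ that(2), of "- 1"]] by (simp add: poly_ring_simps)
qed

lemma monomial_in_monomial_ideal:
  assumes "L \<subseteq> carrier (poly_ring V)" "f \<in> Idl\<^bsub>poly_ring V\<^esub> L"
    and L: "\<And>l. l \<in> L \<Longrightarrow> \<exists>k\<in>K. keys l \<subseteq> {k}" and m: "m \<in> keys f"
  shows "\<exists>k\<in>K. mon_dvd k m"
proof -
  have "\<forall>m\<in>keys f. \<exists>k\<in>K. mon_dvd k m"
    using assms(2,1)
  proof (induction rule: ideal_induct)
    case (add p q)
    then show ?case using Poly_Mapping.keys_add[of p q] by blast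
  next
    case (monomial u c b)
    then obtain k where k: "k \<in> K" "keys b \<subseteq> {k}" using L by blast
    have "keys (single u c * b) \<subseteq> {u + k}"
      using keys_mult[of "single u c" b] keys_single_subset[of u c] k(2) by blast
    then show ?case using k(1) mon_dvd_add[OF mon_dvd_refl] by blast
  qed simp
  with m show ?thesis by blast
qed

text \<open>
  Membership of monomials in monomial ideals is divisibility by a generator, which turns both
  conditions on a reduced Groebner basis into divisibility statements.
\<close>
lemma reduced_groebner_basisI:
  assumes "finite G" "G \<subseteq> I" "I \<subseteq> carrier (poly_ring V)"
    and lc: "\<And>g. g \<in> G \<Longrightarrow> leading_coeff g = 1"
    and lead: "\<And>f. f \<in> I \<Longrightarrow> f \<noteq> 0 \<Longrightarrow> \<exists>g\<in>G. mon_dvd (leading_monomial g) (leading_monomial f)"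
    and red: "\<And>g h m. g \<in> G \<Longrightarrow> h \<in> G \<Longrightarrow> h \<noteq> g \<Longrightarrow> m \<in> keys g \<Longrightarrow> \<not> mon_dvd (leading_monomial h) m"
  shows "reduced_groebner_basis V I G"
proof -
  interpret cring "poly_ring V" by (rule poly_ring_cring)
  have nz: "g \<noteq> 0" if "g \<in> G" for g using lc[OF that] by (auto simp: leading_coeff_def)
  have LT: "leading_term ` A \<subseteq> carrier (poly_ring V)" if "A \<subseteq> I - {0}" for A
  proof
    fix t assume "t \<in> leading_term ` A"
    then obtain f where f: "f \<in> A" "t = leading_term f" by blast
    then have "leading_monomial f \<in> keys f" "f \<in> carrier (poly_ring V)"
      using leading_monomial_in_keys that assms(3) by blast+
    then show "t \<in> carrier (poly_ring V)"
      unfolding f leading_term_def by (intro single_in_carrier) (simp add: poly_ring_simps)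
  qed
  have GI: "G \<subseteq> I - {0}" using assms(2) nz by blast
  have "leading_term ` (I - {0}) \<subseteq> Idl\<^bsub>poly_ring V\<^esub> (leading_term ` G)"
  proof
    fix t assume "t \<in> leading_term ` (I - {0})"
    then obtain f where f: "f \<in> I" "f \<noteq> 0" "t = leading_term f" by blast
    obtain g where g: "g \<in> G" "mon_dvd (leading_monomial g) (leading_monomial f)"
      using lead f by blast
    let ?u = "leading_monomial f - leading_monomial g"
    have "single ?u (leading_coeff f) \<in> carrier (poly_ring V)"
    proof (rule single_in_carrier)
      show "keys ?u \<subseteq> V"
        using keys_diff_subset[of "leading_monomial f" "leading_monomial g"]
          leading_monomial_in_keys[OF f(2)] subsetD[OF assms(3) f(1)]
        unfolding poly_ring_simps by blast
    qed
    moreover have "leading_term g \<in> Idl\<^bsub>poly_ring V\<^esub> (leading_term ` G)"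
      using g(1) by (intro gen_in_ideal LT[OF GI]) blast
    ultimately have "single ?u (leading_coeff f) * leading_term g \<in> Idl\<^bsub>poly_ring V\<^esub> (leading_term ` G)"
      by (rule mult_in_ideal[OF LT[OF GI]])
    then show "t \<in> Idl\<^bsub>poly_ring V\<^esub> (leading_term ` G)"
      using lc[OF g(1)] mon_dvd_imp_diff_add[OF g(2)]
      by (simp add: f(3) leading_term_def mult_single)
  qed
  then have "Idl\<^bsub>poly_ring V\<^esub> (leading_term ` (I - {0})) \<subseteq> Idl\<^bsub>poly_ring V\<^esub> (leading_term ` G)"
    by (intro genideal_minimal genideal_ideal LT[OF GI])
  moreover have "Idl\<^bsub>poly_ring V\<^esub> (leading_term ` G) \<subseteq> Idl\<^bsub>poly_ring V\<^esub> (leading_term ` (I - {0}))"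
    by (intro genideal_minimal genideal_ideal LT)
      (use GI gen_in_ideal[OF LT[OF subset_refl]] in auto)
  moreover have "monomial m \<notin> Idl\<^bsub>poly_ring V\<^esub> (leading_term ` (G - {g}))"
    if g: "g \<in> G" "m \<in> keys g" for g m
  proof
    assume "monomial m \<in> Idl\<^bsub>poly_ring V\<^esub> (leading_term ` (G - {g}))"
    moreover have "leading_term ` (G - {g}) \<subseteq> carrier (poly_ring V)"
      by (rule LT) (use GI in blast)
    moreover have "\<exists>k\<in>leading_monomial ` (G - {g}). keys l \<subseteq> {k}"
      if l: "l \<in> leading_term ` (G - {g})" for l
    proof -
      obtain h where "h \<in> G - {g}" "l = leading_term h" using l by blast
      then show ?thesis
        by (intro bexI[of _ "leading_monomial h"]) (auto simp: leading_term_def)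
    qed
    moreover have "m \<in> keys (monomial m)" by (simp add: monomial_def)
    ultimately have "\<exists>k\<in>leading_monomial ` (G - {g}). mon_dvd k m"
      by (intro monomial_in_monomial_ideal[where f = "monomial m"])
    then show False using red g by blast
  qed
  ultimately show ?thesis
    using assms(1,2) lc unfolding reduced_groebner_basis_def groebner_basis_def by auto
qed

section \<open>Linear functionals\<close>

text \<open>The linear functional that takes the value \<open>w m\<close> at the monomial \<open>m\<close>.\<close>
definition functional :: "('a mon \<Rightarrow> real) \<Rightarrow> 'a rpoly \<Rightarrow> real" where
  "functional w p = (\<Sum>m\<in>keys p. lookup p m * w m)"

lemma functional_superset:
  assumes "finite A" "keys p \<subseteq> A"
  shows "functional w p = (\<Sum>m\<in>A. lookup p m * w m)"
  unfolding functional_def using assms by (intro sum.mono_neutral_left) (auto simp: in_keys_iff)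

lemma functional_zero [simp]: "functional w 0 = 0"
  by (simp add: functional_def)

lemma functional_add: "functional w (p + q) = functional w p + functional w q"
proof -
  let ?A = "keys p \<union> keys q"
  have "keys (p + q) \<subseteq> ?A" by (rule Poly_Mapping.keys_add)
  then show ?thesis
    by (simp add: functional_superset[where A = ?A] lookup_add sum.distrib distrib_right)
qed

lemma functional_diff: "functional w (p - q) = functional w p - functional w q"
  using functional_add[of w "p - q" q] by simp

lemma functional_sum: "functional w (\<Sum>a\<in>A. f a) = (\<Sum>a\<in>A. functional w (f a))"
  by (induction A rule: infinite_finite_induct) (auto simp: functional_add)

lemma functional_single [simp]: "functional w (single m c) = c * w m"
  by (subst functional_superset[where A = "{m}"]) auto

lemma functional_eq_single:
  assumes "m \<in> keys f" "\<And>m'. m' \<in> keys f \<Longrightarrow> m' \<noteq> m \<Longrightarrow> w m' = 0"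
  shows "functional w f = lookup f m * w m"
proof -
  have "functional w f = (\<Sum>m'\<in>{m}. lookup f m' * w m')"
    unfolding functional_def using assms by (intro sum.mono_neutral_right) auto
  then show ?thesis by simp
qed

text \<open>
  The sum of the coefficients of \<open>f\<close> over the class of its leading monomial is a functional that
  vanishes on the ideal: multiplying a generator by a monomial keeps its two monomials in a
  common class, where their coefficients cancel.  Were the leading monomial alone in its
  class, this sum would be the leading coefficient.
\<close>
lemma leading_monomial_not_fibre_minimum:
  fixes R :: "'a::linorder mon \<Rightarrow> 'a mon \<Rightarrow> bool"
  assumes f: "f \<in> Idl\<^bsub>poly_ring V\<^esub> B" "f \<noteq> 0" and B: "B \<subseteq> carrier (poly_ring V)"
    and gens: "\<And>b. b \<in> B \<Longrightarrow> \<exists>m m'. b = monomial m - monomial m' \<and> R m m'"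
    and R: "equivp R" "\<And>u m m'. R m m' \<Longrightarrow> R (u + m) (u + m')"
  shows "\<exists>m\<in>keys f. grevlex_less m (leading_monomial f) \<and> R (leading_monomial f) m"
proof (rule ccontr)
  assume no: "\<not> ?thesis"
  let ?l = "leading_monomial f"
  define w where "w m = (if R ?l m then 1 else 0 :: real)" for m
  have "functional w f = 0"
    using f(1) B
  proof (induction rule: ideal_induct)
    case (monomial u c b)
    obtain m m' where b: "b = monomial m - monomial m'" "R m m'" using gens monomial by blast
    have "w (u + m) = w (u + m')"
      using R(2)[OF b(2), of u] R(1) unfolding w_def by (metis equivp_symp equivp_transp)
    then show ?case
      by (simp add: b(1) right_diff_distrib monomial_def mult_single functional_diff)
  qed (auto simp: functional_add)
  moreover have "functional w f = lookup f ?l * w ?l"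
    using no leading_monomial[OF f(2)] by (intro functional_eq_single) (auto simp: w_def)
  moreover have "w ?l = 1" using R(1) by (simp add: w_def equivp_reflp)
  ultimately show False using leading_monomial_in_keys[OF f(2)] by (simp add: in_keys_iff)
qed


section \<open>Tuples and slices\<close>

lemma list_le_if_nth_le:
  fixes a b :: "nat list"
  assumes "length a = length b" "\<And>i. i < length a \<Longrightarrow> a ! i \<le> b ! i"
  shows "a \<le> b"
  using assms
proof (induction a b rule: list_induct2)
  case (Cons x xs y ys)
  have "x \<le> y" using Cons.prems[of 0] by simp
  moreover have "xs \<le> ys" using Cons.prems[of "Suc _"] by (intro Cons.IH) auto
  ultimately show ?case by auto
qed simp

lemma grid_nth_le: "a \<in> grid n \<Longrightarrow> i < length n \<Longrightarrow> a ! i \<le> n ! i"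
  by (auto simp: grid_def)

lemma grid_le_if_nth_le:
  assumes "a \<in> grid n" "b \<in> grid n" "\<And>i. i < length n \<Longrightarrow> a ! i \<le> b ! i"
  shows "a \<le> b"
  using assms by (intro list_le_if_nth_le) (auto simp: grid_def)

lemma grid_eqI:
  assumes "a \<in> grid n" "b \<in> grid n" "\<And>i. i < length n \<Longrightarrow> a ! i = b ! i"
  shows "a = b"
  using assms by (intro nth_equalityI) (auto simp: grid_def)

lemma meet_in_grid: "a \<in> grid n \<Longrightarrow> b \<in> grid n \<Longrightarrow> meet a b \<in> grid n"
  and join_in_grid: "a \<in> grid n \<Longrightarrow> b \<in> grid n \<Longrightarrow> join a b \<in> grid n"
  by (auto simp: grid_def meet_def join_def min_def max_def)

lemma meet_nth: "a \<in> grid n \<Longrightarrow> b \<in> grid n \<Longrightarrow> i < length n \<Longrightarrow> meet a b ! i = min (a ! i) (b ! i)"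
  and join_nth: "a \<in> grid n \<Longrightarrow> b \<in> grid n \<Longrightarrow> i < length n \<Longrightarrow> join a b ! i = max (a ! i) (b ! i)"
  by (auto simp: grid_def meet_def join_def)

lemma meet_bar_nth: "i < length n \<Longrightarrow>
    meet_bar n a b ! i = (if a ! i \<noteq> b ! i then min (a ! i) (b ! i) else n ! i)"
  and join_bar_nth: "i < length n \<Longrightarrow>
    join_bar n a b ! i = (if a ! i \<noteq> b ! i then max (a ! i) (b ! i) else n ! i)"
  by (simp_all add: meet_bar_def join_bar_def)

lemma meet_bar_in_grid: "a \<in> grid n \<Longrightarrow> b \<in> grid n \<Longrightarrow> meet_bar n a b \<in> grid n"
  and join_bar_in_grid: "a \<in> grid n \<Longrightarrow> b \<in> grid n \<Longrightarrow> join_bar n a b \<in> grid n"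
  by (auto simp: grid_def meet_bar_def join_bar_def min_def max_def)

text \<open>
  The exponent of \<open>t\<^sub>i\<^sub>,\<^sub>k\<close> in the image of the monomial under \<open>x\<^sub>a \<mapsto> \<Prod>\<^sub>i t\<^sub>i\<^sub>,\<^sub>a\<^sub>i\<close>.
\<close>
definition slice :: "nat \<Rightarrow> nat \<Rightarrow> nat list mon \<Rightarrow> nat" where
  "slice i k = weight (\<lambda>a. if a ! i = k then 1 else 0)"

lemma slice_pos_iff: "slice i k m > 0 \<longleftrightarrow> (\<exists>a\<in>keys m. a ! i = k)"
proof -
  have "slice i k m = 0 \<longleftrightarrow> (\<forall>a\<in>keys m. a ! i \<noteq> k)"
    unfolding slice_def weight_def by (simp add: in_keys_iff)
  then show ?thesis by auto
qed

lemma slice_single: "slice i k (single a l) = (if a ! i = k then l else 0)"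
  by (simp add: slice_def)

lemma slice_add: "slice i k (m + m') = slice i k m + slice i k m'"
  by (simp add: slice_def weight_add)

lemma slice_pair:
  "slice i k (pair a b) = (if a ! i = k then 1 else 0) + (if b ! i = k then 1 else 0)"
  unfolding pair_def slice_add slice_single ..

lemma weight_differences: "weight \<omega> m + weight \<omega> (m' - m) = weight \<omega> m' + weight \<omega> (m - m')"
  by (metis max_of_monomials weight_add)

section \<open>Chains\<close>

text \<open>
  The slices determine the degree only if tuples are nonempty, so the degree is recorded separately.
\<close>
definition same_slices :: "nat list \<Rightarrow> nat list mon \<Rightarrow> nat list mon \<Rightarrow> bool" where
  "same_slices n m m' \<longleftrightarrow> total_degree m = total_degree m' \<and>
     (\<forall>i<length n. \<forall>k. slice i k m = slice i k m')"

lemma equivp_same_slices: "equivp (same_slices n)"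
  by (intro equivpI reflpI sympI transpI) (auto simp: same_slices_def)

lemma same_slices_add: "same_slices n m m' \<Longrightarrow> same_slices n (u + m) (u + m')"
  by (simp add: same_slices_def slice_add total_degree_add)

lemma same_slices_differences:
  assumes "same_slices n m m'"
  shows "same_slices n (m - m') (m' - m)"
  using assms weight_differences[of "\<lambda>_. 1" m m']
    weight_differences[of "\<lambda>a. if a ! i = k then 1 else 0" m m' for i k]
  unfolding same_slices_def slice_def total_degree_eq_weight
  by (metis add_left_cancel)

lemma same_slices_meet_join:
  assumes "a \<in> grid n" "b \<in> grid n"
  shows "same_slices n (pair a b) (pair (meet a b) (join a b))"
  using assms by (auto simp: same_slices_def slice_pair meet_nth join_nth min_def max_def)

definition is_chain :: "nat list \<Rightarrow> nat list mon \<Rightarrow> bool" where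
  "is_chain n m \<longleftrightarrow> (\<forall>a\<in>keys m. \<forall>b\<in>keys m. a < b \<longrightarrow> (\<forall>i<length n. a ! i \<le> b ! i))"

lemma is_chain_subset: "is_chain n m \<Longrightarrow> keys l \<subseteq> keys m \<Longrightarrow> is_chain n l"
  unfolding is_chain_def by blast

text \<open>
  Let \<open>a\<close> be the last index at which the monomials differ; there the smaller one has the larger
  exponent.  After cancellation let \<open>c\<close> be the top of the remaining chain, so that \<open>c < a\<close>.  Since the slices agree, each coordinate
  of \<open>a\<close> is a coordinate of some chain element and hence at most that of \<open>c\<close>; so \<open>a \<le> c\<close>.
\<close>
lemma chain_grevlex_minimal:
  assumes "keys m \<subseteq> grid n" "keys m' \<subseteq> grid n" "is_chain n m" "same_slices n m m'"
  shows "\<not> grevlex_less m' m"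
proof
  assume "grevlex_less m' m"
  then obtain a where a: "a \<in> keys (m' - m)" "\<And>b. b \<in> keys (m - m') \<Longrightarrow> b < a"
    using assms(4) by (elim grevlex_differenceE) (auto simp: same_slices_def)
  have sl: "same_slices n (m - m') (m' - m)" by (rule same_slices_differences[OF assms(4)])
  have chain: "is_chain n (m - m')" by (rule is_chain_subset[OF assms(3) keys_diff_subset])
  have "m - m' \<noteq> 0"
    using sl a(1) total_degree_eq_0_iff[of "m - m'"] total_degree_eq_0_iff[of "m' - m"]
    by (auto simp: same_slices_def)
  then have ne: "keys (m - m') \<noteq> {}" by (simp add: keys_empty_iff)
  define c where "c = Max (keys (m - m'))"
  have c: "c \<in> keys (m - m')" "\<And>b. b \<in> keys (m - m') \<Longrightarrow> b \<le> c"
    using ne by (auto simp: c_def)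
  have "a ! i \<le> c ! i" if i: "i < length n" for i
  proof -
    have "slice i (a ! i) (m' - m) > 0" using a(1) slice_pos_iff by blast
    then have "slice i (a ! i) (m - m') > 0" using sl i by (simp add: same_slices_def)
    then obtain b where b: "b \<in> keys (m - m')" "b ! i = a ! i" using slice_pos_iff by blast
    with c chain i show ?thesis unfolding is_chain_def
      by (metis order.order_iff_strict order_refl)
  qed
  then have "a \<le> c"
    using a(1) c(1) assms(1,2) keys_diff_subset[of m m'] keys_diff_subset[of m' m]
    by (intro grid_le_if_nth_le[of _ n]) blast+
  with a(2)[OF c(1)] show False by simp
qed

section \<open>The ideal of the meet-join binomials\<close>

lemma monomial_in_carrier: "keys m \<subseteq> V \<Longrightarrow> monomial m \<in> carrier (poly_ring V)"
  unfolding monomial_def by (rule single_in_carrier)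

lemma diff_in_carrier:
  "p \<in> carrier (poly_ring V) \<Longrightarrow> q \<in> carrier (poly_ring V) \<Longrightarrow> p - q \<in> carrier (poly_ring V)"
  unfolding poly_ring_simps using keys_diff[of p q] by blast

lemma binomials_eq: "binomials n =
    {monomial (pair a b) - monomial (pair (meet a b) (join a b)) | a b. a \<in> grid n \<and> b \<in> grid n}"
  by (simp add: binomials_def var_times_var)

lemma gb_0_eq: "gb_0 n =
    {monomial (pair a b) - monomial (pair (meet a b) (join a b)) | a b.
       a \<in> grid n \<and> b \<in> grid n \<and> a < b \<and> (\<exists>i<length n. a ! i > b ! i)}"
  by (simp add: gb_0_def var_times_var)

lemma binomials_in_carrier: "binomials n \<subseteq> carrier (poly_ring (grid n))"
proof
  fix p assume "p \<in> binomials n"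
  then obtain a b where "p = monomial (pair a b) - monomial (pair (meet a b) (join a b))"
    "a \<in> grid n" "b \<in> grid n" by (auto simp: binomials_eq)
  then show "p \<in> carrier (poly_ring (grid n))"
    by (auto intro!: diff_in_carrier monomial_in_carrier meet_in_grid join_in_grid)
qed

lemma finite_gb_0: "finite (gb_0 n)"
proof (rule finite_subset)
  show "gb_0 n \<subseteq> (\<lambda>(a, b). monomial (pair a b) - monomial (pair (meet a b) (join a b))) ` (grid n \<times> grid n)"
    by (auto simp: gb_0_eq)
qed (simp add: finite_grid)

lemma grevlex_meet_join:
  assumes "a \<in> grid n" "b \<in> grid n" "a < b" "i < length n" "a ! i > b ! i"
  shows "grevlex_less (pair (meet a b) (join a b)) (pair a b)"
proof (rule grevlex_pair)
  note grid = assms(1,2) meet_in_grid[OF assms(1,2)] join_in_grid[OF assms(1,2)]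
  have "b \<le> join a b" by (rule grid_le_if_nth_le) (use grid join_nth in auto)
  moreover have "b \<noteq> join a b" using join_nth[OF assms(1,2,4)] assms(5) by auto
  ultimately show "b < join a b" by simp
  with \<open>a < b\<close> show "a < join a b" by simp
  show "meet a b \<le> join a b"
    by (rule grid_le_if_nth_le) (use grid in \<open>auto simp: join_nth meet_nth\<close>)
qed

lemma gb_0_divides_non_chain:
  assumes "keys m \<subseteq> grid n" "\<not> is_chain n m"
  shows "\<exists>g\<in>gb_0 n. mon_dvd (leading_monomial g) m"
proof -
  obtain a b i where ab: "a \<in> keys m" "b \<in> keys m" "a < b" "i < length n" "a ! i > b ! i"
    using assms(2) unfolding is_chain_def by (auto simp: not_le)
  have grid: "a \<in> grid n" "b \<in> grid n" using ab assms(1) by auto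
  let ?g = "monomial (pair a b) - monomial (pair (meet a b) (join a b))"
  have "leading_monomial ?g = pair a b"
    using grevlex_meet_join[OF grid ab(3-5)] by (rule leading_binomial)
  moreover have "?g \<in> gb_0 n" unfolding gb_0_eq using grid ab by blast
  moreover have "mon_dvd (pair a b) m" using ab by (simp add: mon_dvd_pair_iff)
  ultimately show ?thesis by metis
qed

text \<open>
  The binomials lie in the kernel of the toric parametrization, so the leading monomial of \<open>f\<close>
  shares its slices with a smaller monomial, which is impossible for a chain.
\<close>
lemma ideal_0_leading_monomial:
  assumes "f \<in> ideal_0 n" "f \<noteq> 0"
  shows "\<not> is_chain n (leading_monomial f)"
proof
  assume chain: "is_chain n (leading_monomial f)"
  have f: "f \<in> carrier (poly_ring (grid n))"
    using ideal_subset_carrier[OF binomials_in_carrier] assms(1) by (auto simp: ideal_0_def)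
  have "\<exists>m\<in>keys f. grevlex_less m (leading_monomial f) \<and> same_slices n (leading_monomial f) m"
    using assms binomials_in_carrier
    by (intro leading_monomial_not_fibre_minimum[where B = "binomials n" and V = "grid n"]
        equivp_same_slices same_slices_add)
      (auto simp: ideal_0_def binomials_eq intro: same_slices_meet_join)
  then obtain m where m: "m \<in> keys f" "grevlex_less m (leading_monomial f)"
    "same_slices n (leading_monomial f) m" by blast
  have "keys m \<subseteq> grid n" "keys (leading_monomial f) \<subseteq> grid n"
    using f m(1) leading_monomial_in_keys[OF assms(2)] by (auto simp: poly_ring_simps)
  then show False using chain_grevlex_minimal chain m by blast
qed

lemma mem_gb_0E:
  assumes "g \<in> gb_0 n"
  obtains a b where "g = monomial (pair a b) - monomial (pair (meet a b) (join a b))"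
    "a \<in> grid n" "b \<in> grid n" "a < b" "\<exists>i<length n. a ! i > b ! i"
    "leading_monomial g = pair a b" "leading_coeff g = 1"
    "keys g = {pair a b, pair (meet a b) (join a b)}"
  using assms grevlex_meet_join leading_binomial unfolding gb_0_eq by blast

lemma meet_le_join:
  assumes "a \<in> grid n" "b \<in> grid n" "i < length n"
  shows "meet a b ! i \<le> join a b ! i"
  using assms by (simp add: meet_nth join_nth)

text \<open>
  An incomparable pair divides \<open>x\<^sub>a x\<^sub>b\<close> only if it is the pair of \<open>a\<close> and \<open>b\<close>, and it never divides
  \<open>x\<^bsub>a\<and>b\<^esub> x\<^bsub>a\<or>b\<^esub>\<close>, whose indices are comparable.
\<close>
lemma gb_0_reduced:
  assumes "g \<in> gb_0 n" "h \<in> gb_0 n" "h \<noteq> g" "m \<in> keys g"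
  shows "\<not> mon_dvd (leading_monomial h) m"
proof
  assume dvd: "mon_dvd (leading_monomial h) m"
  obtain a b where g: "g = monomial (pair a b) - monomial (pair (meet a b) (join a b))"
    "a \<in> grid n" "b \<in> grid n" "a < b"
    "keys g = {pair a b, pair (meet a b) (join a b)}"
    using assms(1) by (rule mem_gb_0E)
  obtain c e where h: "h = monomial (pair c e) - monomial (pair (meet c e) (join c e))"
    "c \<in> grid n" "e \<in> grid n" "c < e" "\<exists>i<length n. c ! i > e ! i"
    "leading_monomial h = pair c e"
    using assms(2) by (rule mem_gb_0E)
  have mem: "c \<in> keys m" "e \<in> keys m" using dvd h(4,6) by (simp_all add: mon_dvd_pair_iff)
  have "m = pair a b \<or> m = pair (meet a b) (join a b)" using assms(4) g(5) by blast
  then show False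
  proof
    assume "m = pair a b"
    then have "c = a" "e = b" using mem g(4) h(4) by auto
    with g(1) h(1) assms(3) show False by simp
  next
    assume "m = pair (meet a b) (join a b)"
    moreover have "meet a b \<le> join a b"
      using g(2,3) by (intro grid_le_if_nth_le[OF meet_in_grid join_in_grid] meet_le_join)
    ultimately have "c = meet a b" "e = join a b" using mem h(4) by auto
    then show False using h(5) meet_le_join[OF g(2,3)] by (metis linorder_not_le)
  qed
qed

lemma reduced_gb_0: "reduced_groebner_basis (grid n) (ideal_0 n) (gb_0 n)"
proof (rule reduced_groebner_basisI)
  note carrier = binomials_in_carrier[of n]
  show "finite (gb_0 n)" by (rule finite_gb_0)
  have "gb_0 n \<subseteq> binomials n" unfolding gb_0_eq binomials_eq by blast
  then show "gb_0 n \<subseteq> ideal_0 n"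
    using gen_in_ideal[OF carrier] unfolding ideal_0_def by blast
  show sub: "ideal_0 n \<subseteq> carrier (poly_ring (grid n))"
    unfolding ideal_0_def by (rule ideal_subset_carrier[OF carrier])
  show "leading_coeff g = 1" if "g \<in> gb_0 n" for g using that by (rule mem_gb_0E)
  show "\<exists>g\<in>gb_0 n. mon_dvd (leading_monomial g) (leading_monomial f)"
    if f: "f \<in> ideal_0 n" "f \<noteq> 0" for f
    using gb_0_divides_non_chain[OF _ ideal_0_leading_monomial[OF f]]
      leading_monomial_in_keys[OF f(2)] subsetD[OF sub f(1)] unfolding poly_ring_simps by blast
qed (rule gb_0_reduced)


section \<open>The ideal of the power sum and the meet-join binomials\<close>

lemma keys_add_mon: "keys (m + m') = keys m \<union> keys m'" for m m' :: "'a mon"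
  by (rule Set.set_eqI) (simp add: in_keys_iff lookup_add)

lemma finite_monomials_of_degree:
  assumes "finite V"
  shows "finite {m :: 'a mon. keys m \<subseteq> V \<and> total_degree m = D}" (is "finite ?M")
proof (rule finite_imageD[of Poly_Mapping.lookup])
  show "inj_on Poly_Mapping.lookup ?M" by (rule inj_onI) (simp add: poly_mapping_eq_iff[symmetric])
  have "lookup m a \<le> total_degree m" for m :: "'a mon" and a
  proof (cases "a \<in> keys m")
    case True
    then show ?thesis unfolding total_degree_def by (intro member_le_sum) auto
  qed (simp add: in_keys_iff)
  then have "Poly_Mapping.lookup ` ?M \<subseteq> {f. \<forall>a. (a \<in> V \<longrightarrow> f a \<in> {..D}) \<and> (a \<notin> V \<longrightarrow> f a = 0)}"
    unfolding image_subset_iff by (auto simp: not_in_keys_iff_lookup_eq_zero)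
  then show "finite (Poly_Mapping.lookup ` ?M)"
    by (rule finite_subset) (intro finite_set_of_finite_funs assms, simp)
qed

text \<open>
  Replacing an incomparable pair by its meet and join decreases a monomial within the finite set of
  monomials of the same degree.  A smallest representative modulo the ideal thus admits no such
  replacement.
\<close>
lemma chain_representative:
  assumes "keys m \<subseteq> grid n"
  obtains s where "keys s \<subseteq> grid n" "is_chain n s" "monomial m - monomial s \<in> ideal_0 n"
proof -
  note add = add_in_ideal[OF binomials_in_carrier, folded ideal_0_def]
  note mult = mult_in_ideal[OF binomials_in_carrier, folded ideal_0_def]
  note gen = gen_in_ideal[OF binomials_in_carrier, folded ideal_0_def]
  let ?T = "{s. keys s \<subseteq> grid n \<and> total_degree s = total_degree m \<and>
      monomial m - monomial s \<in> ideal_0 n}"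
  have "finite ?T"
    by (rule finite_subset[OF _ finite_monomials_of_degree[OF finite_grid, of n "total_degree m"]]) auto
  moreover have "m \<in> ?T"
    using assms zero_in_ideal[OF binomials_in_carrier] by (simp add: ideal_0_def)
  ultimately obtain s where s: "s \<in> ?T" and min: "\<And>s'. s' \<in> ?T \<Longrightarrow> s' \<noteq> s \<Longrightarrow> \<not> grevlex_less s' s"
    using Finite_Set.bex_min_element[OF _ asymp_grevlex transp_grevlex, of ?T] by blast
  have "is_chain n s"
  proof (rule ccontr)
    assume "\<not> is_chain n s"
    then obtain a b i where ab: "a \<in> keys s" "b \<in> keys s" "a < b" "i < length n" "a ! i > b ! i"
      unfolding is_chain_def by (auto simp: not_le)
    have grid: "a \<in> grid n" "b \<in> grid n" using ab s by auto
    define u where "u = s - pair a b"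
    define s' where "s' = u + pair (meet a b) (join a b)"
    have s_eq: "s = u + pair a b"
      unfolding u_def by (rule mon_dvd_imp_diff_add[symmetric]) (use ab in \<open>simp add: mon_dvd_pair_iff\<close>)
    have u: "keys u \<subseteq> grid n" using s keys_diff_subset[of s "pair a b"] by (auto simp: u_def)
    have less: "grevlex_less s' s"
      unfolding s_eq s'_def using grevlex_meet_join[OF grid ab(3-5)] by simp
    have "monomial u * (monomial (pair a b) - monomial (pair (meet a b) (join a b))) \<in> ideal_0 n"
      by (intro mult gen monomial_in_carrier u) (use grid in \<open>auto simp: binomials_eq\<close>)
    moreover have "monomial u * (monomial (pair a b) - monomial (pair (meet a b) (join a b)))
        = monomial s - monomial s'"
      by (simp add: s_eq s'_def monomial_def mult_single right_diff_distrib)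
    ultimately have "monomial s - monomial s' \<in> ideal_0 n" by simp
    then have "monomial m - monomial s' \<in> ideal_0 n"
      using s add[where p = "monomial m - monomial s" and q = "monomial s - monomial s'"] by simp
    moreover have "keys s' \<subseteq> grid n"
      using u grid by (simp add: s'_def keys_add_mon meet_in_grid join_in_grid)
    moreover have "total_degree s' = total_degree s"
      by (simp add: s_eq s'_def total_degree_add)
    ultimately have "s' \<in> ?T" using s by simp
    moreover have "s' \<noteq> s" using less by auto
    ultimately show False using min less by blast
  qed
  with s that show thesis by blast
qed

locale positive_grid =
  fixes n :: "nat list"
  assumes positive: "\<And>i. i < length n \<Longrightarrow> n ! i \<ge> 1"
begin

definition least_tuple :: "nat list" where
  "least_tuple = replicate (length n) 1"

lemma least_tuple_in_grid: "least_tuple \<in> grid n"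
  using positive by (simp add: grid_def least_tuple_def)

lemma least_tuple_nth_le: "a \<in> grid n \<Longrightarrow> i < length n \<Longrightarrow> least_tuple ! i \<le> a ! i"
  by (simp add: grid_def least_tuple_def)

lemma least_tuple_le: "a \<in> grid n \<Longrightarrow> least_tuple \<le> a"
  using least_tuple_in_grid least_tuple_nth_le by (intro grid_le_if_nth_le)

text \<open>The polynomial whose real zeros, for even \<open>p\<close>, form the unit sphere of the \<open>p\<close>-norm.\<close>
definition sphere :: "nat \<Rightarrow> nat list rpoly" where
  "sphere p = (\<Sum>a\<in>grid n. var a ^ p) - 1"

lemma
  assumes "p > 0"
  shows leading_monomial_sphere: "leading_monomial (sphere p) = single least_tuple p"
    and leading_coeff_sphere: "leading_coeff (sphere p) = 1"
    and keys_sphere: "keys (sphere p) = insert 0 ((\<lambda>a. single a p) ` grid n)"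
  using leading_power_sum[OF finite_grid least_tuple_in_grid least_tuple_le assms]
  by (simp_all add: sphere_def)

lemma sphere_in_carrier: "p > 0 \<Longrightarrow> sphere p \<in> carrier (poly_ring (grid n))"
  unfolding poly_ring_simps(1) by (auto simp: keys_sphere split: if_splits)

text \<open>The smallest tuple is comparable to every other tuple.\<close>
lemma is_chain_add_least_tuple:
  assumes "keys m \<subseteq> grid n" "is_chain n m"
  shows "is_chain n (m + single least_tuple k)"
  unfolding is_chain_def keys_add_mon
proof (intro ballI impI allI)
  fix a b i assume *: "a \<in> keys m \<union> keys (single least_tuple k)" "b \<in> keys m \<union> keys (single least_tuple k)"
    "a < b" "i < length n"
  have sub: "keys (single least_tuple k) \<subseteq> {least_tuple}" by simp
  have grid: "a \<in> grid n" "b \<in> grid n" using * assms(1) sub least_tuple_in_grid by blast+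
  show "a ! i \<le> b ! i"
  proof (cases "a = least_tuple")
    case True
    then show ?thesis using least_tuple_nth_le[OF grid(2) *(4)] by simp
  next
    case False
    have "b \<noteq> least_tuple" using least_tuple_le[OF grid(1)] *(3) by auto
    with False * sub have "a \<in> keys m" "b \<in> keys m" by blast+
    then show ?thesis using assms(2) *(3,4) unfolding is_chain_def by blast
  qed
qed

lemma ideal_p_generators: "p > 0 \<Longrightarrow> insert (sphere p) (binomials n) \<subseteq> carrier (poly_ring (grid n))"
  using sphere_in_carrier binomials_in_carrier by blast

lemma ideal_p_eq: "ideal_p p n = Idl\<^bsub>poly_ring (grid n)\<^esub> (insert (sphere p) (binomials n))"
  by (simp add: ideal_p_def sphere_def)

text \<open>
  In a multiple of the generator \<open>\<Sum> x\<^sub>a\<^sup>p - 1\<close> the cofactor may be changed by elements of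
  \<open>ideal_0 n\<close>, because that change is absorbed by \<open>g\<close>; so its monomials can be
  replaced by chain representatives.
\<close>
lemma ideal_p_decomposition:
  assumes "f \<in> ideal_p p n" "p > 0"
  shows "\<exists>h g. f = h * sphere p + g \<and> g \<in> ideal_0 n \<and>
    (\<forall>m\<in>keys h. keys m \<subseteq> grid n \<and> is_chain n m)"
proof -
  note zero_mem = zero_in_ideal[OF binomials_in_carrier, folded ideal_0_def]
  note mult = mult_in_ideal[OF binomials_in_carrier, folded ideal_0_def]
  note gen = gen_in_ideal[OF binomials_in_carrier, folded ideal_0_def]
  show ?thesis
    using assms(1)[unfolded ideal_p_eq] ideal_p_generators[OF assms(2)]
  proof (induction rule: ideal_induct)
    case zero
    show ?case by (intro exI[of _ 0]) (simp add: zero_mem)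
  next
    case (add f f')
    then obtain h g h' g' where *: "f = h * sphere p + g" "f' = h' * sphere p + g'"
      "g \<in> ideal_0 n" "g' \<in> ideal_0 n"
      "\<forall>m\<in>keys h. keys m \<subseteq> grid n \<and> is_chain n m" "\<forall>m\<in>keys h'. keys m \<subseteq> grid n \<and> is_chain n m"
      by blast
    have "f + f' = (h + h') * sphere p + (g + g')" using * by (simp add: algebra_simps)
    moreover have "g + g' \<in> ideal_0 n"
      using * add_in_ideal[OF binomials_in_carrier, folded ideal_0_def] by blast
    moreover have "\<forall>m\<in>keys (h + h'). keys m \<subseteq> grid n \<and> is_chain n m"
      using * Poly_Mapping.keys_add[of h h'] by blast
    ultimately show ?case by blast
  next
    case (monomial u c b)
    show ?case
    proof (cases "b = sphere p")
      case True
      obtain s where s: "keys s \<subseteq> grid n" "is_chain n s" "monomial u - monomial s \<in> ideal_0 n"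
        using chain_representative[OF monomial(1)] by blast
      have c: "single 0 c * sphere p \<in> carrier (poly_ring (grid n))"
        using sphere_in_carrier[OF assms(2)] single_in_carrier[of 0 "grid n" c]
          cring.cring_simprules(5)[OF poly_ring_cring, of "single 0 c" "grid n" "sphere p"]
        by (simp add: poly_ring_simps(2))
      have "single u c * b = single s c * sphere p
          + (single 0 c * sphere p) * (monomial u - monomial s)"
        by (simp add: True monomial_def right_diff_distrib mult.commute[of _ "sphere p"]
            mult.assoc mult_single)
      with mult[OF c s(3)] s(1,2) show ?thesis
        by (intro exI[of _ "single s c"] exI conjI) (auto split: if_splits)
    next
      case False
      then have "single u c * b \<in> ideal_0 n"
        using monomial by (intro mult gen single_in_carrier) auto
      then show ?thesis by (intro exI[of _ 0] exI[of _ "single u c * b"]) simp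
    qed
  qed
qed

lemma gb_p_eq: "gb_p p n = insert (sphere p) (gb_0 n)"
  by (simp add: gb_p_def sphere_def)

text \<open>
  The leading monomials of the two summands of \<open>f\<close> differ, as one is supported on a chain and the
  other is not.  A leading monomial of \<open>f\<close> that is supported on a chain comes from the
  multiple of \<open>\<Sum> x\<^sub>a\<^sup>p - 1\<close>.
\<close>
lemma ideal_p_leading_monomial:
  assumes f: "f \<in> ideal_p p n" "f \<noteq> 0" and p: "p > 0"
    and chain: "is_chain n (leading_monomial f)"
  shows "mon_dvd (single least_tuple p) (leading_monomial f)"
proof -
  obtain h g where hg: "f = h * sphere p + g" "g \<in> ideal_0 n"
    "\<And>m. m \<in> keys h \<Longrightarrow> keys m \<subseteq> grid n \<and> is_chain n m"
    using ideal_p_decomposition[OF f(1) p] by blast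
  have S: "sphere p \<noteq> 0" using leading_coeff_sphere[OF p] by (auto simp: leading_coeff_def)
  have "h \<noteq> 0" using hg f(2) chain ideal_0_leading_monomial[of g n] by auto
  let ?q = "h * sphere p"
  let ?M = "leading_monomial h + single least_tuple p"
  have q: "?q \<noteq> 0" "leading_monomial ?q = ?M"
    using leading_monomial_mult[OF \<open>h \<noteq> 0\<close> S] leading_monomial_sphere[OF p] by simp_all
  have M: "is_chain n ?M"
    using hg(3)[OF leading_monomial_in_keys[OF \<open>h \<noteq> 0\<close>]] by (intro is_chain_add_least_tuple) auto
  have "leading_monomial f = ?M"
  proof (cases "g = 0")
    case True
    then show ?thesis using hg(1) q(2) by simp
  next
    case False
    have notchain: "\<not> is_chain n (leading_monomial g)" by (rule ideal_0_leading_monomial[OF hg(2) False])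
    then have "leading_monomial g \<noteq> ?M" using M by auto
    then consider "grevlex_less (leading_monomial g) ?M" | "grevlex_less ?M (leading_monomial g)"
      using grevlex_total by blast
    then show ?thesis
    proof cases
      case 1
      then show ?thesis using leading_monomial_add[OF q(1) False] q(2) hg(1) by simp
    next
      case 2
      then have "leading_monomial f = leading_monomial g"
        using leading_monomial_add[OF False q(1)] q(2) hg(1) by (simp add: add.commute)
      with chain notchain show ?thesis by simp
    qed
  qed
  then show ?thesis by (simp add: mon_dvd_add)
qed

lemma reduced_gb_p:
  assumes "p \<ge> 2"
  shows "reduced_groebner_basis (grid n) (ideal_p p n) (gb_p p n)"
proof (rule reduced_groebner_basisI)
  have p: "p > 0" using assms by simp
  note carrier = ideal_p_generators[OF p]
  show "finite (gb_p p n)" by (simp add: gb_p_eq finite_gb_0)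
  have "gb_p p n \<subseteq> insert (sphere p) (binomials n)"
    unfolding gb_p_eq gb_0_eq binomials_eq by blast
  then show "gb_p p n \<subseteq> ideal_p p n"
    using gen_in_ideal[OF carrier] unfolding ideal_p_eq by blast
  show sub: "ideal_p p n \<subseteq> carrier (poly_ring (grid n))"
    unfolding ideal_p_eq by (rule ideal_subset_carrier[OF carrier])
  show "leading_coeff g = 1" if "g \<in> gb_p p n" for g
    using that leading_coeff_sphere[OF p] unfolding gb_p_eq by (auto elim: mem_gb_0E)
  show "\<exists>g\<in>gb_p p n. mon_dvd (leading_monomial g) (leading_monomial f)"
    if f: "f \<in> ideal_p p n" "f \<noteq> 0" for f
  proof (cases "is_chain n (leading_monomial f)")
    case True
    then show ?thesis
      using ideal_p_leading_monomial[OF f p] leading_monomial_sphere[OF p] by (simp add: gb_p_eq)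
  next
    case False
    have "keys (leading_monomial f) \<subseteq> grid n"
      using leading_monomial_in_keys[OF f(2)] subsetD[OF sub f(1)] unfolding poly_ring_simps by blast
    then show ?thesis using gb_0_divides_non_chain[OF _ False] by (auto simp: gb_p_eq)
  qed
  show "\<not> mon_dvd (leading_monomial h) m"
    if gh: "g \<in> gb_p p n" "h \<in> gb_p p n" "h \<noteq> g" "m \<in> keys g" for g h m
  proof
    assume dvd: "mon_dvd (leading_monomial h) m"
    consider "g = sphere p" "h \<in> gb_0 n" | "h = sphere p" "g \<in> gb_0 n" | "g \<in> gb_0 n" "h \<in> gb_0 n"
      using gh(1-3) unfolding gb_p_eq by blast
    then show False
    proof cases
      case 1
      from 1(2) obtain a b where "leading_monomial h = pair a b" "a < b" by (rule mem_gb_0E)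
      then have "a \<in> keys m" "b \<in> keys m" "a \<noteq> b" using dvd by (simp_all add: mon_dvd_pair_iff)
      moreover obtain c where "keys m \<subseteq> {c}"
        using gh(4) keys_sphere[OF p] p unfolding 1(1) by auto
      ultimately show False by blast
    next
      case 2
      have two: "lookup m least_tuple \<ge> 2"
        using dvd assms by (simp add: 2(1) leading_monomial_sphere[OF p] mon_dvd_single_iff)
      from 2(2) obtain a b where ab: "a \<in> grid n" "b \<in> grid n" "a < b" "\<exists>i<length n. a ! i > b ! i"
        "keys g = {pair a b, pair (meet a b) (join a b)}" by (rule mem_gb_0E)
      obtain i where i: "i < length n" "a ! i > b ! i" using ab(4) by blast
      then have "meet a b ! i \<noteq> join a b ! i"
        using meet_nth[OF ab(1,2) i(1)] join_nth[OF ab(1,2) i(1)] by simp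
      then have "meet a b \<noteq> join a b" by auto
      then show False using two gh(4) ab(3,5) by (auto simp: lookup_pair split: if_splits)
    next
      case 3
      then show False using gb_0_reduced[OF 3(1,2) gh(3,4)] dvd by blast
    qed
  qed
qed

section \<open>The ideal of the signed unit vectors\<close>

definition gens_1 :: "nat list rpoly set" where
  "gens_1 = {var a ^ 3 - var a | a. a \<in> grid n}
      \<union> {var a * var b | a b. a \<in> grid n \<and> b \<in> grid n \<and> a \<noteq> b}
      \<union> {sphere 2}"

lemma cube_eq: "var a ^ 3 - var a = monomial (single a 3) - monomial (single a 1)"
  unfolding var_power by (simp only: var_def)

lemma gens_1E:
  assumes "b \<in> gens_1"
  obtains (cube) a where "a \<in> grid n" "b = monomial (single a 3) - monomial (single a 1)"
  | (product) a c where "a \<in> grid n" "c \<in> grid n" "a \<noteq> c" "b = monomial (pair a c)"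
  | (norm) "b = sphere 2"
  using assms by (auto simp: gens_1_def var_times_var cube_eq)

lemma gens_1_in_carrier: "gens_1 \<subseteq> carrier (poly_ring (grid n))"
proof
  fix b assume "b \<in> gens_1"
  then show "b \<in> carrier (poly_ring (grid n))"
    by (cases b rule: gens_1E)
      (auto intro!: diff_in_carrier monomial_in_carrier sphere_in_carrier)
qed

lemma ideal_1_eq: "ideal_1 n = Idl\<^bsub>poly_ring (grid n)\<^esub> gens_1"
  by (simp add: ideal_1_def gens_1_def sphere_def)

text \<open>
  The associated functional sends \<open>f\<close> to \<open>(f(e\<^sub>a) + f(-e\<^sub>a)) / 2\<close> if \<open>e\<close> is true and to
  \<open>(f(e\<^sub>a) - f(-e\<^sub>a)) / 2\<close> otherwise, where \<open>e\<^sub>a\<close> is the unit vector.  Keeping only the monomials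
  in \<open>x\<^sub>a\<close> of a given parity turns vanishing into statements about single coefficients.
\<close>
definition axis_weight :: "nat list \<Rightarrow> bool \<Rightarrow> nat list mon \<Rightarrow> real" where
  "axis_weight a e m = (if keys m \<subseteq> {a} \<and> even (lookup m a) = e then 1 else 0)"

lemma axis_weight_add_single:
  assumes "k > 0"
  shows "axis_weight a e (u + single c k) = (if c = a then axis_weight a (e = even k) u else 0)"
  using assms by (auto simp: axis_weight_def keys_add_mon lookup_add)

text \<open>All generators vanish at the points \<open>\<plusminus>e\<^sub>a\<close>.\<close>
lemma functional_axis_weight:
  assumes "f \<in> ideal_1 n" "a \<in> grid n"
  shows "functional (axis_weight a e) f = 0"
  using assms(1)[unfolded ideal_1_eq] gens_1_in_carrier
proof (induction rule: ideal_induct)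
  case (monomial u k b)
  from monomial(2) show ?case
  proof (cases b rule: gens_1E)
    case (cube c)
    then show ?thesis
      by (simp add: monomial_def right_diff_distrib mult_single functional_diff axis_weight_add_single)
  next
    case (product c c')
    have "axis_weight a e (u + pair c c') = 0"
      using product(3) by (auto simp: axis_weight_def keys_add_mon)
    then show ?thesis by (simp add: product monomial_def mult_single)
  next
    case norm
    have "single u k * b = (\<Sum>c\<in>grid n. single (u + single c 2) k) - single u k"
      by (simp add: norm sphere_def var_power monomial_def right_diff_distrib
          sum_distrib_left mult_single)
    then have "functional (axis_weight a e) (single u k * b)
        = (\<Sum>c\<in>grid n. k * axis_weight a e (u + single c 2)) - k * axis_weight a e u"
      by (simp add: functional_diff functional_sum)
    also have "(\<Sum>c\<in>grid n. k * axis_weight a e (u + single c 2))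
        = (\<Sum>c\<in>grid n. if c = a then k * axis_weight a e u else 0)"
      by (intro sum.cong) (auto simp: axis_weight_add_single)
    also have "\<dots> = k * axis_weight a e u" using assms(2) by (simp add: finite_grid)
    finally show ?thesis by simp
  qed
qed (simp_all add: functional_add)

lemma eq_single: "keys m \<subseteq> {a} \<Longrightarrow> m = single a (lookup m a)"
  by (rule poly_mapping_eqI) (auto simp: lookup_single when_def not_in_keys_iff_lookup_eq_zero[symmetric])

lemma axis_coefficient_zero:
  assumes f: "f \<in> ideal_1 n" "a \<in> grid n"
    and only: "\<And>j. single a j \<in> keys f \<Longrightarrow> even j = even k \<Longrightarrow> j = k"
  shows "single a k \<notin> keys f"
proof
  assume mem: "single a k \<in> keys f"
  have "functional (axis_weight a (even k)) f
      = lookup f (single a k) * axis_weight a (even k) (single a k)"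
  proof (rule functional_eq_single[OF mem])
    fix m assume m: "m \<in> keys f" "m \<noteq> single a k"
    show "axis_weight a (even k) m = 0"
    proof (rule ccontr)
      assume "axis_weight a (even k) m \<noteq> 0"
      then have keys: "keys m \<subseteq> {a}" and parity: "even (lookup m a) = even k"
        by (auto simp: axis_weight_def split: if_splits)
      obtain j where j: "m = single a j" using eq_single[OF keys] by (rule that)
      have "single a j \<in> keys f" "even j = even k" using m(1) parity unfolding j by simp_all
      then have "j = k" by (rule only)
      with j m(2) show False by simp
    qed
  qed
  moreover have "axis_weight a (even k) (single a k) = 1" by (simp add: axis_weight_def)
  ultimately show False
    using functional_axis_weight[OF f] mem by (simp add: in_keys_iff)
qed

lemma gb_1_eq: "gb_1 n = {monomial (pair a b) | a b. a \<in> grid n \<and> b \<in> grid n \<and> a < b}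
    \<union> {sphere 2}
    \<union> {monomial (single a 3) - monomial (single a 1) | a. a \<in> grid n \<and> least_tuple < a}"
  by (simp add: gb_1_def sphere_def least_tuple_def var_times_var cube_eq)

lemma grevlex_single_1_3: "grevlex_less (single a 1) (single a 3)"
  by (simp add: grevlex_less_def)

lemma mem_gb_1E:
  assumes "g \<in> gb_1 n"
  obtains (product) a b where "a \<in> grid n" "b \<in> grid n" "a < b" "g = monomial (pair a b)"
    "leading_monomial g = pair a b" "leading_coeff g = 1" "keys g = {pair a b}"
  | (norm) "g = sphere 2" "leading_monomial g = single least_tuple 2" "leading_coeff g = 1"
    "keys g = insert 0 ((\<lambda>a. single a 2) ` grid n)"
  | (cube) a where "a \<in> grid n" "least_tuple < a" "g = monomial (single a 3) - monomial (single a 1)"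
    "leading_monomial g = single a 3" "leading_coeff g = 1" "keys g = {single a 3, single a 1}"
proof -
  from assms consider a b where "a \<in> grid n" "b \<in> grid n" "a < b" "g = monomial (pair a b)"
    | "g = sphere 2"
    | a where "a \<in> grid n" "least_tuple < a" "g = monomial (single a 3) - monomial (single a 1)"
    unfolding gb_1_eq by blast
  then show thesis
  proof cases
    case 1
    show thesis
      by (rule product[OF 1]) (simp_all only: 1(4) leading_monomial_monomial)
  next
    case 2
    show thesis
      by (rule norm[OF 2]) (simp_all add: 2 leading_monomial_sphere leading_coeff_sphere
          keys_sphere)
  next
    case 3
    show thesis
      by (rule cube[OF 3]) (simp_all only: 3(3) leading_binomial[OF grevlex_single_1_3])
  qed
qed

text \<open>
  A standard leading monomial is \<open>x\<^sub>a\<^sup>k\<close> with \<open>k \<le> 2\<close>, and \<open>k \<le> 1\<close> if \<open>a\<close> is the smallest tuple.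
  By \<open>axis_coefficient_zero\<close> some other power of \<open>x\<^sub>a\<close> with the same parity occurs in \<open>f\<close>.
  This must be the constant term, with \<open>k = 2\<close>.  The square of the variable of the smallest tuple
  exceeds \<open>x\<^sub>a\<^sup>2\<close> and so does not occur in \<open>f\<close>; evaluating at the smallest tuple then shows
  that \<open>f\<close> has no constant term.
\<close>
lemma gb_1_leading_monomial:
  assumes f: "f \<in> ideal_1 n" "f \<noteq> 0"
  shows "\<exists>g\<in>gb_1 n. mon_dvd (leading_monomial g) (leading_monomial f)"
proof (rule ccontr)
  let ?l = "leading_monomial f"
  assume no: "\<not> ?thesis"
  have "f \<in> carrier (poly_ring (grid n))"
    using ideal_subset_carrier[OF gens_1_in_carrier] f(1) by (auto simp: ideal_1_eq)
  then have l_grid: "keys ?l \<subseteq> grid n"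
    using leading_monomial_in_keys[OF f(2)] unfolding poly_ring_simps by blast
  have less_2: "lookup ?l least_tuple < 2"
  proof -
    have "sphere 2 \<in> gb_1 n" by (simp add: gb_1_eq)
    then have "\<not> mon_dvd (single least_tuple 2) ?l" using no leading_monomial_sphere[of 2] by fastforce
    then show ?thesis by (simp add: mon_dvd_single_iff)
  qed
  have less_3: "lookup ?l a < 3" if "a \<in> keys ?l" "a \<noteq> least_tuple" for a
  proof -
    have a: "a \<in> grid n" "least_tuple < a" using that l_grid least_tuple_le[of a] by auto
    then have "monomial (single a 3) - monomial (single a 1) \<in> gb_1 n" by (auto simp: gb_1_eq)
    then have "\<not> mon_dvd (single a 3) ?l"
      using no leading_binomial(1)[OF grevlex_single_1_3[of a]] by metis
    then show ?thesis by (simp add: mon_dvd_single_iff)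
  qed
  have "a = b" if "a \<in> keys ?l" "b \<in> keys ?l" for a b
  proof (rule ccontr)
    assume "a \<noteq> b"
    with that obtain a' b' where ab: "a' \<in> keys ?l" "b' \<in> keys ?l" "a' < b'"
      by (metis linorder_less_linear)
    then have "monomial (pair a' b') \<in> gb_1 n" using l_grid by (auto simp: gb_1_eq)
    then have "\<not> mon_dvd (pair a' b') ?l" using no leading_monomial_monomial(1) by metis
    then show False using ab by (simp add: mon_dvd_pair_iff)
  qed
  then have "\<exists>a\<in>grid n. keys ?l \<subseteq> {a}"
    using l_grid least_tuple_in_grid by (cases "keys ?l = {}") blast+
  then obtain a where "a \<in> grid n" and keys: "keys ?l \<subseteq> {a}" by blast
  define k where "k = lookup ?l a"
  have l: "?l = single a k" unfolding k_def by (rule eq_single[OF keys])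
  have k: "k \<le> 2" "a = least_tuple \<Longrightarrow> k \<le> 1"
    using less_2 less_3[of a] by (cases "a = least_tuple"; cases "a \<in> keys ?l"; simp add: k_def in_keys_iff)+
  have mem: "single a k \<in> keys f" using leading_monomial_in_keys[OF f(2)] by (simp add: l)
  have le: "j \<le> k" if "single b j \<in> keys f" for b j
  proof -
    have "total_degree (single b j) \<le> total_degree (single a k)"
      using grevlex_less_leading_monomial[OF f(2) that] unfolding l
      by (cases "single b j = single a k") (auto simp: grevlex_less_def simp del: total_degree_single)
    then show ?thesis by simp
  qed
  have "single a j \<in> keys f \<Longrightarrow> even j = even k \<Longrightarrow> j = k" for j
  proof (rule ccontr)
    assume j: "single a j \<in> keys f" "even j = even k" "j \<noteq> k"
    then have "j < k" using le[OF j(1)] by simp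
    then have jk: "j = 0" "k = 2" using j(2) k(1) by presburger+
    then have "a \<noteq> least_tuple" using k(2) by auto
    then have "least_tuple < a" using least_tuple_le[OF \<open>a \<in> grid n\<close>] by (simp add: less_le)
    have "single least_tuple 0 \<notin> keys f"
    proof (rule axis_coefficient_zero[OF f(1) least_tuple_in_grid])
      fix i assume i: "single least_tuple i \<in> keys f" "even i = even (0::nat)"
      have "i \<noteq> 2"
      proof
        assume "i = 2"
        then have "grevlex_less ?l (single least_tuple i)"
          unfolding l jk using \<open>least_tuple < a\<close> by (simp add: grevlex_single)
        then show False
          using grevlex_less_leading_monomial[OF f(2) i(1)] grevlex_asym[of ?l "single least_tuple i"]
          by (cases "single least_tuple i = ?l") simp_all
      qed
      then show "i = 0" using le[OF i(1)] i(2) jk(2) by presburger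
    qed
    then show False using j(1) jk(1) by simp
  qed
  then have "single a k \<notin> keys f" by (rule axis_coefficient_zero[OF f(1) \<open>a \<in> grid n\<close>])
  with mem show False by contradiction
qed

lemma reduced_gb_1: "reduced_groebner_basis (grid n) (ideal_1 n) (gb_1 n)"
proof (rule reduced_groebner_basisI)
  note carrier = gens_1_in_carrier
  have "gb_1 n \<subseteq> (\<lambda>(a, b). monomial (pair a b)) ` (grid n \<times> grid n) \<union> {sphere 2}
      \<union> (\<lambda>a. monomial (single a 3) - monomial (single a 1)) ` grid n"
    by (auto simp: gb_1_eq)
  then show "finite (gb_1 n)" by (rule finite_subset) (simp add: finite_grid)
  have "gb_1 n \<subseteq> gens_1"
    by (auto simp: gb_1_eq gens_1_def var_times_var cube_eq)
  then show "gb_1 n \<subseteq> ideal_1 n" using gen_in_ideal[OF carrier] unfolding ideal_1_eq by blast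
  show "ideal_1 n \<subseteq> carrier (poly_ring (grid n))"
    unfolding ideal_1_eq by (rule ideal_subset_carrier[OF carrier])
  show "leading_coeff g = 1" if "g \<in> gb_1 n" for g
    using that by (cases g rule: mem_gb_1E) auto
  show "\<not> mon_dvd (leading_monomial h) m"
    if gh: "g \<in> gb_1 n" "h \<in> gb_1 n" "h \<noteq> g" "m \<in> keys g" for g h m
    using gh(2)
  proof (cases h rule: mem_gb_1E)
    case h: (product a b)
    have "\<not> {a, b} \<subseteq> keys m"
      using gh(1)
    proof (cases g rule: mem_gb_1E)
      case (product c e)
      have "{a, b} \<subseteq> {c, e} \<longleftrightarrow> a = c \<and> b = e" using h(3) product(3) by auto
      then show ?thesis using gh(3,4) h(4) product(4,7) by auto
    qed (use gh(4) h(3) in auto)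
    then show ?thesis using h(3,5) by (simp add: mon_dvd_pair_iff)
  next
    case h: norm
    from gh(1) show ?thesis
    proof (cases g rule: mem_gb_1E)
      case (product c e)
      then show ?thesis using gh(4) h(2) by (auto simp: mon_dvd_single_iff lookup_pair)
    next
      case norm
      then show ?thesis using gh(3) h(1) by simp
    next
      case (cube c)
      then show ?thesis
        using gh(4) h(2) by (auto simp: mon_dvd_single_iff lookup_single when_def split: if_splits)
    qed
  next
    case h: (cube a)
    from gh(1) show ?thesis
    proof (cases g rule: mem_gb_1E)
      case (product c e)
      then show ?thesis using gh(4) h(4) by (auto simp: mon_dvd_single_iff lookup_pair)
    next
      case norm
      then show ?thesis
        using gh(4) h(4) by (auto simp: mon_dvd_single_iff lookup_single when_def split: if_splits)
    next
      case (cube c)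
      then show ?thesis using gh(3,4) h(3,4)
        by (auto simp: mon_dvd_single_iff lookup_single when_def split: if_splits)
    qed
  qed
qed (rule gb_1_leading_monomial)

end


section \<open>The ideal of the sign vectors of rank one\<close>

text \<open>
  On vectors with entries \<open>\<plusminus>1\<close> a monomial depends only on its exponents modulo 2, so the toric
  exponents matter only modulo 2 there.
\<close>
definition same_parities :: "nat list \<Rightarrow> nat list mon \<Rightarrow> nat list mon \<Rightarrow> bool" where
  "same_parities n m m' \<longleftrightarrow> even (total_degree m) = even (total_degree m') \<and>
     (\<forall>i<length n. \<forall>k. even (slice i k m) = even (slice i k m'))"

lemma equivp_same_parities: "equivp (same_parities n)"
  by (intro equivpI reflpI sympI transpI) (auto simp: same_parities_def)

lemma same_parities_add: "same_parities n m m' \<Longrightarrow> same_parities n (u + m) (u + m')"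
  by (simp add: same_parities_def slice_add total_degree_add)

lemma same_slices_imp_same_parities: "same_slices n m m' \<Longrightarrow> same_parities n m m'"
  by (simp add: same_slices_def same_parities_def)

lemma same_parities_square: "same_parities n (single a 2) 0"
  by (auto simp: same_parities_def slice_single slice_def weight_def)

lemma even_weight_differences:
  assumes "even (weight \<omega> m) = even (weight \<omega> m')"
  shows "even (weight \<omega> (m - m')) = even (weight \<omega> (m' - m))"
proof -
  have "even (weight \<omega> m + weight \<omega> (m' - m)) = even (weight \<omega> m' + weight \<omega> (m - m'))"
    by (simp only: weight_differences)
  then show ?thesis using assms unfolding even_add by blast
qed

lemma same_parities_differences:
  "same_parities n m m' \<Longrightarrow> same_parities n (m - m') (m' - m)"
  unfolding same_parities_def slice_def total_degree_eq_weight
  by (simp add: even_weight_differences)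

text \<open>
  The supports are chains in which each coordinate increases strictly until it reaches its maximal value
  \<open>n ! i\<close>.  Repetitions are allowed only at that value, since the bar operations
  replace every other repeated coordinate.
\<close>
definition is_strict_chain :: "nat list \<Rightarrow> nat list mon \<Rightarrow> bool" where
  "is_strict_chain n m \<longleftrightarrow> (\<forall>a. lookup m a \<le> 1) \<and>
     (\<forall>a\<in>keys m. \<forall>b\<in>keys m. a < b \<longrightarrow>
        (\<forall>i<length n. a ! i < b ! i \<or> a ! i = n ! i \<and> b ! i = n ! i))"

lemma is_strict_chain_diff: "is_strict_chain n m \<Longrightarrow> is_strict_chain n (m - l)"
  using keys_diff_subset[of m l] unfolding is_strict_chain_def lookup_minus
  by (meson diff_le_self order_trans subsetD)

lemma strict_chain_lookup: "is_strict_chain n m \<Longrightarrow> a \<in> keys m \<Longrightarrow> lookup m a = 1"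
  unfolding is_strict_chain_def in_keys_iff by (metis le_antisym less_one not_le)

lemma strict_chain_total_degree:
  assumes "is_strict_chain n m"
  shows "total_degree m = card (keys m)"
  unfolding total_degree_def using strict_chain_lookup[OF assms] by simp

lemma card_keys_le_total_degree: "card (keys m) \<le> total_degree m"
proof -
  have "(\<Sum>a\<in>keys m. 1) \<le> (\<Sum>a\<in>keys m. lookup m a)"
    by (intro sum_mono) (simp add: in_keys_iff Suc_le_eq)
  then show ?thesis by (simp add: total_degree_def)
qed

lemma strict_chain_distinct_nth:
  assumes "is_strict_chain n m" "a \<in> keys m" "b \<in> keys m" "i < length n" "a ! i = b ! i" "a ! i < n ! i"
  shows "a = b"
  using assms unfolding is_strict_chain_def by (metis less_irrefl linorder_less_linear)

lemma strict_chain_slice: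
  assumes "is_strict_chain n m" "b \<in> keys m" "i < length n" "b ! i < n ! i"
  shows "slice i (b ! i) m = 1"
proof -
  have "slice i (b ! i) m = (\<Sum>a\<in>keys m. if a = b then 1 else 0)"
    unfolding slice_def weight_def
  proof (rule sum.cong)
    fix a assume a: "a \<in> keys m"
    show "lookup m a * (if a ! i = b ! i then 1 else 0) = (if a = b then 1 else 0)"
      using strict_chain_distinct_nth[OF assms(1) a assms(2,3)] assms(4)
        strict_chain_lookup[OF assms(1) a] by auto
  qed simp
  then show ?thesis using assms(2) by simp
qed

text \<open>
  Elements of a strict chain with nonmaximal \<open>i\<close>-th coordinate have pairwise distinct \<open>i\<close>-th
  coordinates, each of which occurs exactly once.  These values have odd slices, so each of
  them also occurs in every monomial of the same class.  If that monomial has no more factors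
  than there are such values, it has no other \<open>i\<close>-th coordinates.
\<close>
lemma strict_chain_forces_coordinates:
  assumes m: "is_strict_chain n m" "same_parities n m m'"
    and B: "B \<subseteq> keys m" "i < length n" "\<And>b. b \<in> B \<Longrightarrow> b ! i < n ! i"
  shows "card B \<le> total_degree m'"
    and "card B = total_degree m' \<Longrightarrow> a \<in> keys m' \<Longrightarrow> a ! i \<in> (\<lambda>b. b ! i) ` B"
proof -
  let ?J = "(\<lambda>b. b ! i) ` B" and ?J' = "(\<lambda>b. b ! i) ` keys m'"
  have "inj_on (\<lambda>b. b ! i) B"
    using strict_chain_distinct_nth[OF m(1)] B by (intro inj_onI) blast
  then have card: "card ?J = card B" by (rule card_image)
  have sub: "?J \<subseteq> ?J'"
  proof
    fix k assume "k \<in> ?J"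
    then obtain b where b: "b \<in> B" "k = b ! i" by blast
    then have "slice i k m = 1" using strict_chain_slice[OF m(1) _ B(2)] B(1,3) by blast
    then have "odd (slice i k m')" using m(2) B(2) by (metis same_parities_def odd_one)
    then have "slice i k m' > 0" by (rule odd_pos)
    then obtain a where "a \<in> keys m'" "a ! i = k" unfolding slice_pos_iff by blast
    then show "k \<in> ?J'" by blast
  qed
  have le: "card ?J' \<le> total_degree m'"
    using card_image_le[of "keys m'" "\<lambda>b. b ! i"] card_keys_le_total_degree[of m'] by simp
  show "card B \<le> total_degree m'"
    using card_mono[OF _ sub] le by (simp add: card)
  show "a ! i \<in> ?J" if "card B = total_degree m'" "a \<in> keys m'"
  proof -
    have "?J = ?J'" using le that(1) by (intro card_seteq sub) (simp_all add: card)
    with that(2) show ?thesis by blast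
  qed
qed

lemma Max_keys:
  assumes "m \<noteq> (0 :: 'a::linorder mon)"
  obtains c where "c \<in> keys m" "\<And>b. b \<in> keys m \<Longrightarrow> b \<le> c"
  using assms by (intro that[of "Max (keys m)"] Max_in Max_ge) (simp_all add: keys_empty_iff)

text \<open>
  The second largest element of the chain has a nonmaximal coordinate \<open>i\<close>, and so have all
  elements below it.  This makes all elements but the largest one contribute a forced \<open>i\<close>-th
  coordinate.  So the degree can drop by at most 1, and the parity of the degree excludes 1.
\<close>
lemma strict_chain_total_degree_minimal:
  assumes "keys m \<subseteq> grid n" "is_strict_chain n m" "same_parities n m m'"
  shows "total_degree m \<le> total_degree m'"
proof (rule ccontr)
  assume "\<not> ?thesis"
  then have less: "total_degree m' < total_degree m" by simp
  have parity: "even (total_degree m) = even (total_degree m')"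
    using assms(3) by (simp add: same_parities_def)
  have deg: "total_degree m = card (keys m)" by (rule strict_chain_total_degree[OF assms(2)])
  have "m \<noteq> 0" using less by auto
  then obtain c where c: "c \<in> keys m" "\<And>b. b \<in> keys m \<Longrightarrow> b \<le> c" by (rule Max_keys) blast
  define B where "B = keys m - {c}"
  have card: "card B = total_degree m - 1" using c(1) by (simp add: B_def deg)
  have "card B \<le> total_degree m'"
  proof (cases "B = {}")
    case False
    have fin: "finite B" by (simp add: B_def)
    define c' where "c' = Max B"
    have c': "c' \<in> B" "\<And>b. b \<in> B \<Longrightarrow> b \<le> c'" using False fin by (auto simp: c'_def)
    have "c' < c" using c(2)[of c'] c'(1) by (simp add: B_def less_le)
    have grid: "c' \<in> grid n" "c \<in> grid n" using c' c assms(1) by (auto simp: B_def)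
    obtain i where i: "i < length n" "c' ! i \<noteq> c ! i"
      using grid_eqI[OF grid] \<open>c' < c\<close> by blast
    moreover have "c' \<in> keys m" using c'(1) by (simp add: B_def)
    then have "c' ! i < c ! i \<or> c' ! i = n ! i \<and> c ! i = n ! i"
      using assms(2) c(1) i(1) \<open>c' < c\<close> unfolding is_strict_chain_def by blast
    ultimately have "c' ! i < c ! i" by linarith
    then have lt: "c' ! i < n ! i" using grid_nth_le[OF grid(2) i(1)] by simp
    show ?thesis
    proof (rule strict_chain_forces_coordinates(1)[OF assms(2,3) _ i(1)])
      show "B \<subseteq> keys m" by (auto simp: B_def)
      fix b assume b: "b \<in> B"
      show "b ! i < n ! i"
      proof (cases "b = c'")
        case False
        then have "b < c'" using c'(2)[OF b] by simp
        moreover have "b \<in> keys m" "c' \<in> keys m" using b c'(1) by (simp_all add: B_def)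
        ultimately have "b ! i < c' ! i \<or> b ! i = n ! i \<and> c' ! i = n ! i"
          using assms(2) i(1) unfolding is_strict_chain_def by blast
        then show ?thesis using lt by linarith
      qed (simp add: lt)
    qed
  qed simp
  with card less parity show False by presburger
qed

text \<open>
  By degree minimality the two monomials have the same degree, and the argument for
  \<open>chain_grevlex_minimal\<close> carries over.  With \<open>c\<close> the top of the remaining chain, a coordinate in which \<open>c\<close> is
  maximal bounds \<open>a\<close> trivially; in any other coordinate the whole chain is nonmaximal and
  forces the coordinates of the smaller monomial, in particular that of \<open>a\<close>.
\<close>
lemma strict_chain_grevlex_minimal:
  assumes "keys m \<subseteq> grid n" "keys m' \<subseteq> grid n" "is_strict_chain n m" "same_parities n m m'"
  shows "\<not> grevlex_less m' m"
proof
  assume less: "grevlex_less m' m"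
  have deg: "total_degree m' = total_degree m"
    using less strict_chain_total_degree_minimal[OF assms(1,3,4)] by (auto simp: grevlex_less_def)
  obtain a where a: "a \<in> keys (m' - m)" "\<And>b. b \<in> keys (m - m') \<Longrightarrow> b < a"
    using grevlex_differenceE[OF less deg] by blast
  have par: "same_parities n (m - m') (m' - m)" by (rule same_parities_differences[OF assms(4)])
  have chain: "is_strict_chain n (m - m')" by (rule is_strict_chain_diff[OF assms(3)])
  have deg': "total_degree (m - m') = total_degree (m' - m)"
    using weight_differences[of "\<lambda>_. 1" m m'] deg by (simp add: total_degree_eq_weight)
  have "m' - m \<noteq> 0" using a(1) by auto
  then have "m - m' \<noteq> 0" using deg' by (metis total_degree_eq_0_iff)
  then obtain c where c: "c \<in> keys (m - m')" "\<And>b. b \<in> keys (m - m') \<Longrightarrow> b \<le> c"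
    by (rule Max_keys) blast
  have grid: "a \<in> grid n" "c \<in> grid n"
    using a(1) c(1) assms(1,2) keys_diff_subset[of m m'] keys_diff_subset[of m' m] by blast+
  have "a ! i \<le> c ! i" if i: "i < length n" for i
  proof (cases "c ! i < n ! i")
    case False
    then show ?thesis using grid_nth_le[OF grid(1) i] by simp
  next
    case True
    have le: "b ! i \<le> c ! i" if "b \<in> keys (m - m')" for b
      using chain c that i unfolding is_strict_chain_def
      by (metis less_imp_le_nat order.order_iff_strict order_refl)
    have "a ! i \<in> (\<lambda>b. b ! i) ` keys (m - m')"
    proof (rule strict_chain_forces_coordinates(2)[OF chain par subset_refl i _ _ a(1)])
      show "b ! i < n ! i" if "b \<in> keys (m - m')" for b using le[OF that] True by simp
      show "card (keys (m - m')) = total_degree (m' - m)"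
        using deg' strict_chain_total_degree[OF chain] by simp
    qed
    with le show ?thesis by auto
  qed
  then have "a \<le> c" using grid by (intro grid_le_if_nth_le[of _ n])
  with a(2)[OF c(1)] show False by simp
qed

definition gens_inf :: "nat list \<Rightarrow> nat list rpoly set" where
  "gens_inf n = {var a ^ 2 - 1 | a. a \<in> grid n} \<union> binomials n"

lemma square_eq: "var a ^ 2 - 1 = monomial (single a 2) - monomial 0"
  unfolding var_power one_eq_monomial ..

lemma gens_infE:
  assumes "b \<in> gens_inf n"
  obtains m m' where "b = monomial m - monomial m'" "keys m \<subseteq> grid n" "keys m' \<subseteq> grid n"
    "same_parities n m m'"
proof -
  from assms consider a where "a \<in> grid n" "b = monomial (single a 2) - monomial 0"
    | a c where "a \<in> grid n" "c \<in> grid n"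
      "b = monomial (pair a c) - monomial (pair (meet a c) (join a c))"
    unfolding gens_inf_def square_eq binomials_eq by blast
  then show thesis
  proof cases
    case 1
    then show thesis by (intro that[OF 1(2)] same_parities_square) simp_all
  next
    case 2
    then show thesis
      by (intro that[OF 2(3)] same_slices_imp_same_parities same_slices_meet_join)
        (simp_all add: meet_in_grid join_in_grid)
  qed
qed

lemma gens_inf_in_carrier: "gens_inf n \<subseteq> carrier (poly_ring (grid n))"
proof
  fix b assume "b \<in> gens_inf n"
  then show "b \<in> carrier (poly_ring (grid n))"
    by (rule gens_infE) (simp add: diff_in_carrier monomial_in_carrier)
qed

lemma ideal_inf_eq: "ideal_inf n = Idl\<^bsub>poly_ring (grid n)\<^esub> (gens_inf n)"
  by (simp add: ideal_inf_def gens_inf_def)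

lemma ideal_inf_leading_monomial:
  assumes "f \<in> ideal_inf n" "f \<noteq> 0"
  shows "\<not> is_strict_chain n (leading_monomial f)"
proof
  assume chain: "is_strict_chain n (leading_monomial f)"
  have f: "f \<in> carrier (poly_ring (grid n))"
    using ideal_subset_carrier[OF gens_inf_in_carrier] assms(1) by (auto simp: ideal_inf_eq)
  have "\<exists>m\<in>keys f. grevlex_less m (leading_monomial f) \<and> same_parities n (leading_monomial f) m"
    by (rule leading_monomial_not_fibre_minimum[OF assms(1)[unfolded ideal_inf_eq] assms(2)
          gens_inf_in_carrier _ equivp_same_parities same_parities_add])
      (elim gens_infE, blast, assumption)
  then obtain m where m: "m \<in> keys f" "grevlex_less m (leading_monomial f)"
    "same_parities n (leading_monomial f) m" by blast
  have "keys m \<subseteq> grid n" "keys (leading_monomial f) \<subseteq> grid n"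
    using f m(1) leading_monomial_in_keys[OF assms(2)] by (auto simp: poly_ring_simps)
  then show False using strict_chain_grevlex_minimal chain m by blast
qed

text \<open>
  Write \<open>p, q\<close> for the meet and join and \<open>p', q'\<close> for their bar versions.  The meet and join of \<open>p'\<close>
  and \<open>q\<close> are \<open>p\<close> and \<open>q'\<close>, so \<open>x\<^bsub>p'\<^esub> x\<^bsub>q\<^esub> \<equiv> x\<^bsub>p\<^esub> x\<^bsub>q'\<^esub>\<close>.  Multiplication by \<open>x\<^bsub>q\<^esub> x\<^bsub>q'\<^esub>\<close> and cancellation of
  squares gives \<open>x\<^bsub>p'\<^esub> x\<^bsub>q'\<^esub> \<equiv> x\<^bsub>p\<^esub> x\<^bsub>q\<^esub> \<equiv> x\<^bsub>a\<^esub> x\<^bsub>b\<^esub>\<close>.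
\<close>
lemma bar_binomial_in_ideal_inf:
  assumes a: "a \<in> grid n" and b: "b \<in> grid n"
  shows "var a * var b - var (meet_bar n a b) * var (join_bar n a b) \<in> ideal_inf n"
proof -
  let ?I = "ideal_inf n"
  define p where "p = meet a b"
  define q where "q = join a b"
  define p' where "p' = meet_bar n a b"
  define q' where "q' = join_bar n a b"
  note defs = p_def q_def p'_def q'_def
  have grid: "p \<in> grid n" "q \<in> grid n" "p' \<in> grid n" "q' \<in> grid n"
    using a b unfolding defs
    by (simp_all add: meet_in_grid join_in_grid meet_bar_in_grid join_bar_in_grid)
  note coordinates = meet_nth[OF a b] join_nth[OF a b] meet_bar_nth join_bar_nth
  have meet: "meet p' q = p"
  proof (rule grid_eqI[OF meet_in_grid[OF grid(3,2)] grid(1)])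
    fix i assume i: "i < length n"
    show "meet p' q ! i = p ! i"
      using grid_nth_le[OF b i] unfolding meet_nth[OF grid(3,2) i] unfolding defs
      by (simp add: coordinates i)
  qed
  have join: "join p' q = q'"
  proof (rule grid_eqI[OF join_in_grid[OF grid(3,2)] grid(4)])
    fix i assume i: "i < length n"
    show "join p' q ! i = q' ! i"
      using grid_nth_le[OF b i] unfolding join_nth[OF grid(3,2) i] unfolding defs
      by (simp add: coordinates i)
  qed
  have binomial: "var c * var e - var (meet c e) * var (join c e) \<in> ?I"
    if "c \<in> grid n" "e \<in> grid n" for c e
    unfolding ideal_inf_eq using that
    by (intro gen_in_ideal gens_inf_in_carrier) (auto simp: gens_inf_def binomials_def)
  have square: "var c ^ 2 - 1 \<in> ?I" if "c \<in> grid n" for c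
    unfolding ideal_inf_eq using that
    by (intro gen_in_ideal gens_inf_in_carrier) (auto simp: gens_inf_def)
  note add = add_in_ideal[OF gens_inf_in_carrier, folded ideal_inf_eq]
  note diff = diff_in_ideal[OF gens_inf_in_carrier, folded ideal_inf_eq]
  note mult = mult_in_ideal[OF gens_inf_in_carrier, folded ideal_inf_eq]
  have vv: "var c * var e \<in> carrier (poly_ring (grid n))" if "c \<in> grid n" "e \<in> grid n" for c e
    unfolding var_times_var using that by (intro monomial_in_carrier) simp
  have "var p' * var q - var p * var q' \<in> ?I"
    using binomial[OF grid(3,2)] by (simp add: meet join)
  note swap = mult[OF vv[OF grid(2,4)] this]
  have "var a * var b - var p * var q \<in> ?I"
    using binomial[OF a b] by (simp add: p_def q_def)
  note start = add[OF this mult[OF vv[OF grid(3,4)] square[OF grid(2)]]]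
  have "(var a * var b - var p * var q) + (var p' * var q') * (var q ^ 2 - 1)
      - (var p * var q) * (var q' ^ 2 - 1)
      - (var q * var q') * (var p' * var q - var p * var q') \<in> ?I"
    by (rule diff[OF diff[OF start mult[OF vv[OF grid(1,2)] square[OF grid(4)]]] swap])
  also have "(var a * var b - var p * var q) + (var p' * var q') * (var q ^ 2 - 1)
      - (var p * var q) * (var q' ^ 2 - 1)
      - (var q * var q') * (var p' * var q - var p * var q') = var a * var b - var p' * var q'"
    by (simp add: algebra_simps power2_eq_square)
  finally show ?thesis by (simp add: p'_def q'_def)
qed

lemma gb_inf_eq: "gb_inf n = {monomial (single a 2) - monomial 0 | a. a \<in> grid n}
    \<union> {monomial (pair a b) - monomial (pair (meet_bar n a b) (join_bar n a b)) | a b.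
          a \<in> grid n \<and> b \<in> grid n \<and> a < b \<and>
          (\<exists>i<length n. a ! i > b ! i \<or> (a ! i = b ! i \<and> b ! i < n ! i))}"
  unfolding gb_inf_def square_eq var_times_var ..

lemma meet_bar_join_bar_strict:
  assumes "a \<in> grid n" "b \<in> grid n" "i < length n"
  shows "meet_bar n a b ! i < join_bar n a b ! i \<or>
    meet_bar n a b ! i = n ! i \<and> join_bar n a b ! i = n ! i"
  using assms by (auto simp: meet_bar_nth join_bar_nth)

lemma meet_bar_less_join_bar:
  assumes "a \<in> grid n" "b \<in> grid n" "a < b"
  shows "meet_bar n a b < join_bar n a b"
proof -
  have "meet_bar n a b \<le> join_bar n a b"
    using meet_bar_join_bar_strict[OF assms(1,2)]
    by (intro grid_le_if_nth_le[OF meet_bar_in_grid join_bar_in_grid] assms) fastforce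
  moreover obtain i where "i < length n" "a ! i \<noteq> b ! i"
    using grid_eqI[OF assms(1,2)] assms(3) by blast
  then have "meet_bar n a b ! i \<noteq> join_bar n a b ! i" by (simp add: meet_bar_nth join_bar_nth)
  ultimately show ?thesis by (metis order.order_iff_strict)
qed

lemma grevlex_meet_bar_join_bar:
  assumes "a \<in> grid n" "b \<in> grid n" "a < b" "i < length n"
    "a ! i > b ! i \<or> (a ! i = b ! i \<and> b ! i < n ! i)"
  shows "grevlex_less (pair (meet_bar n a b) (join_bar n a b)) (pair a b)"
proof (rule grevlex_pair)
  have "b \<le> join_bar n a b"
    using assms(1,2) grid_nth_le[OF assms(2)]
    by (intro grid_le_if_nth_le[OF _ join_bar_in_grid]) (simp_all add: join_bar_nth)
  moreover have "b ! i \<noteq> join_bar n a b ! i"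
    using assms(4,5) by (auto simp: join_bar_nth)
  ultimately show "b < join_bar n a b" by (metis order.order_iff_strict)
  with \<open>a < b\<close> show "a < join_bar n a b" by simp
  show "meet_bar n a b \<le> join_bar n a b"
    using meet_bar_less_join_bar[OF assms(1-3)] by simp
qed

lemma grevlex_zero_square: "grevlex_less 0 (single a 2)"
  by (simp add: grevlex_less_def)

lemma mem_gb_infE:
  assumes "g \<in> gb_inf n"
  obtains (square) a where "a \<in> grid n" "g = monomial (single a 2) - monomial 0"
    "leading_monomial g = single a 2" "leading_coeff g = 1" "keys g = {single a 2, 0}"
  | (binomial) a b where
    "g = monomial (pair a b) - monomial (pair (meet_bar n a b) (join_bar n a b))"
    "a \<in> grid n" "b \<in> grid n" "a < b"
    "\<exists>i<length n. a ! i > b ! i \<or> (a ! i = b ! i \<and> b ! i < n ! i)"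
    "leading_monomial g = pair a b" "leading_coeff g = 1"
    "keys g = {pair a b, pair (meet_bar n a b) (join_bar n a b)}"
proof -
  from assms consider a where "a \<in> grid n" "g = monomial (single a 2) - monomial 0"
    | a b where "g = monomial (pair a b) - monomial (pair (meet_bar n a b) (join_bar n a b))"
      "a \<in> grid n" "b \<in> grid n" "a < b"
      "\<exists>i<length n. a ! i > b ! i \<or> (a ! i = b ! i \<and> b ! i < n ! i)"
    unfolding gb_inf_eq by blast
  then show thesis
  proof cases
    case 1
    show thesis
      by (rule square[OF 1]) (simp_all only: 1(2) leading_binomial[OF grevlex_zero_square])
  next
    case 2
    then have "grevlex_less (pair (meet_bar n a b) (join_bar n a b)) (pair a b)"
      using grevlex_meet_bar_join_bar by blast
    from leading_binomial[OF this] show thesis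
      by (intro binomial[OF 2]) (simp_all only: 2(1))
  qed
qed

lemma gb_inf_divides_non_strict_chain:
  assumes "keys m \<subseteq> grid n" "\<not> is_strict_chain n m"
  shows "\<exists>g\<in>gb_inf n. mon_dvd (leading_monomial g) m"
proof (cases "\<forall>a. lookup m a \<le> 1")
  case False
  then obtain a where a: "lookup m a \<ge> 2" by (metis Suc_1 not_less_eq_eq One_nat_def)
  then have "a \<in> keys m" by (simp add: in_keys_iff)
  then have "monomial (single a 2) - monomial 0 \<in> gb_inf n" using assms(1) by (auto simp: gb_inf_eq)
  moreover have "mon_dvd (single a 2) m" using a by (simp add: mon_dvd_single_iff)
  ultimately show ?thesis using leading_binomial(1)[OF grevlex_zero_square] by metis
next
  case True
  then obtain a b i where ab: "a \<in> keys m" "b \<in> keys m" "a < b" "i < length n"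
    and not: "\<not> a ! i < b ! i" "\<not> (a ! i = n ! i \<and> b ! i = n ! i)"
    using assms(2) unfolding is_strict_chain_def by blast
  have grid: "a \<in> grid n" "b \<in> grid n" using ab assms(1) by auto
  have i: "a ! i > b ! i \<or> (a ! i = b ! i \<and> b ! i < n ! i)"
    using not grid_nth_le[OF grid(2) ab(4)] by linarith
  let ?g = "monomial (pair a b) - monomial (pair (meet_bar n a b) (join_bar n a b))"
  have "leading_monomial ?g = pair a b"
    using grevlex_meet_bar_join_bar[OF grid ab(3,4) i] by (rule leading_binomial)
  moreover have "?g \<in> gb_inf n" unfolding gb_inf_eq using grid ab i by blast
  moreover have "mon_dvd (pair a b) m" using ab by (simp add: mon_dvd_pair_iff)
  ultimately show ?thesis by metis
qed

lemma gb_inf_reduced: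
  assumes "g \<in> gb_inf n" "h \<in> gb_inf n" "h \<noteq> g" "m \<in> keys g"
  shows "\<not> mon_dvd (leading_monomial h) m"
  using assms(2)
proof (cases h rule: mem_gb_infE)
  case h: (square c)
  from assms(1) show ?thesis
  proof (cases g rule: mem_gb_infE)
    case (square a)
    then show ?thesis using assms(3,4) h(2,3)
      by (auto simp: mon_dvd_single_iff lookup_single when_def split: if_splits)
  next
    case (binomial a b)
    have "meet_bar n a b \<noteq> join_bar n a b"
      using meet_bar_less_join_bar[OF binomial(2-4)] by simp
    then have "lookup m c \<le> 1" using assms(4) binomial(4,8) by (auto simp: lookup_pair)
    then show ?thesis by (simp add: h(3) mon_dvd_single_iff)
  qed
next
  case h: (binomial c e)
  have "\<not> {c, e} \<subseteq> keys m"
    using assms(1)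
  proof (cases g rule: mem_gb_infE)
    case (square a)
    then show ?thesis using assms(4) h(4) by auto
  next
    case (binomial a b)
    let ?p = "meet_bar n a b" and ?q = "join_bar n a b"
    have "m = pair a b \<or> m = pair ?p ?q" using assms(4) binomial(8) by blast
    then show ?thesis
    proof
      assume "m = pair a b"
      moreover have "\<not> (c = a \<and> e = b)" using binomial(1) h(1) assms(3) by auto
      ultimately show ?thesis using binomial(4) h(4) by auto
    next
      assume "m = pair ?p ?q"
      moreover have "\<not> (c = ?p \<and> e = ?q)"
        using h(5) meet_bar_join_bar_strict[OF binomial(2,3)] by fastforce
      ultimately show ?thesis using meet_bar_less_join_bar[OF binomial(2-4)] h(4) by auto
    qed
  qed
  then show ?thesis using h(4,6) by (simp add: mon_dvd_pair_iff)
qed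

lemma reduced_gb_inf: "reduced_groebner_basis (grid n) (ideal_inf n) (gb_inf n)"
proof (rule reduced_groebner_basisI)
  note carrier = gens_inf_in_carrier[of n]
  have "gb_inf n \<subseteq> (\<lambda>a. monomial (single a 2) - monomial 0) ` grid n
    \<union> (\<lambda>(a, b). monomial (pair a b) - monomial (pair (meet_bar n a b) (join_bar n a b))) ` (grid n \<times> grid n)"
    by (auto simp: gb_inf_eq)
  then show "finite (gb_inf n)" by (rule finite_subset) (simp add: finite_grid)
  show "gb_inf n \<subseteq> ideal_inf n"
  proof
    fix g assume "g \<in> gb_inf n"
    then consider a where "a \<in> grid n" "g = var a ^ 2 - 1"
      | a b where "a \<in> grid n" "b \<in> grid n" "g = var a * var b - var (meet_bar n a b) * var (join_bar n a b)"
      unfolding gb_inf_def by blast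
    then show "g \<in> ideal_inf n"
    proof cases
      case 1
      then show ?thesis
        unfolding ideal_inf_eq by (intro gen_in_ideal[OF carrier]) (auto simp: gens_inf_def)
    qed (simp add: bar_binomial_in_ideal_inf)
  qed
  show sub: "ideal_inf n \<subseteq> carrier (poly_ring (grid n))"
    unfolding ideal_inf_eq by (rule ideal_subset_carrier[OF carrier])
  show "leading_coeff g = 1" if "g \<in> gb_inf n" for g
    using that by (cases g rule: mem_gb_infE)
  show "\<exists>g\<in>gb_inf n. mon_dvd (leading_monomial g) (leading_monomial f)"
    if f: "f \<in> ideal_inf n" "f \<noteq> 0" for f
    using gb_inf_divides_non_strict_chain[OF _ ideal_inf_leading_monomial[OF f]]
      leading_monomial_in_keys[OF f(2)] subsetD[OF sub f(1)] unfolding poly_ring_simps by blast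
qed (rule gb_inf_reduced)

theorem theorem2p4:
  fixes d :: nat and n :: "nat list"
  assumes "d \<ge> 1" and "length n = d" and "\<forall>i<d. n ! i \<ge> 1"
  shows "reduced_groebner_basis (grid n) (ideal_0 n) (gb_0 n) \<and>
    reduced_groebner_basis (grid n) (ideal_1 n) (gb_1 n) \<and>
    (\<forall>p::nat. even p \<and> p \<ge> 2 \<longrightarrow>
       reduced_groebner_basis (grid n) (ideal_p p n) (gb_p p n)) \<and>
    reduced_groebner_basis (grid n) (ideal_inf n) (gb_inf n)"
proof -
  interpret positive_grid n
    using assms by unfold_locales simp
  show ?thesis
    using reduced_gb_0 reduced_gb_1 reduced_gb_p reduced_gb_inf by blast
qed

end
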